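(* Let $m,n$ be positive integers and let $f:\mathbb{R}^{m\times n}\to\mathbb{R}\cup\{+\infty\}$ be equal to a polynomial on its effective domain $\operatorname{dom} f=\{Z\in\mathbb{R}^{m\times n}: g_1(Z)\ge0,\dots,g_s(Z)\ge0\}$, where $g_1,\dots,g_s$ are polynomials. Let $d_g=\max_{i\in\{1,\dots,s\}}\deg g_i$ and let $X\in\mathbb{R}^{m\times n}$. Let $y^*\in\mathscr{R}^{k^*}$ be an optimal solution of the moment relaxation of order $k^*$ (with $k^*\ge d_g$ and $2k^*\ge\max\{\deg f,m,n\}$), that is, of the minimization problem defining $f_{\rm mom}^{k^*}(X)$. Suppose that $r:=\operatorname{rank}M_{k^*}(y^* )=\operatorname{rank}M_{k^*-d_g}(y^* )$. Then $f_{\rm mom}^k(X)=f_{pc}(X)$ for all integers $k\ge k^*$, and $y^*$ is the vector of moments of an atomic measure supported on matrices $X_1,\dots,X_r\in\operatorname{dom} f$.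
   Context: Let $N=\sum_{j=1}^{\min(m,n)}\binom{m}{j}\binom{n}{j}$ and let $p:\mathbb{R}^{m\times n}\to\mathbb{R}^N$ map a matrix to the list of all its minors of orders $1,\dots,\min(m,n)$. A function $h:\mathbb{R}^{m\times n}\to\mathbb{R}\cup\{+\infty\}$ is polyconvex if $h=g\circ p$ for some convex $g:\mathbb{R}^N\to\mathbb{R}\cup\{+\infty\}$. The polyconvex envelope is $f_{pc}(X)=\sup_h h(X)$ over all polyconvex $h:\mathbb{R}^{m\times n}\to\mathbb{R}\cup\{+\infty\}$ with $h\le f$ everywhere. $\mathbb{R}[Z]_j$ is the space of real polynomials of degree at most $j$ in the entries of $Z\in\mathbb{R}^{m\times n}$, and $\Sigma_k[Z]$ is the cone of finite sums of squares of elements of $\mathbb{R}[Z]_k$. In $\deg f$ and $\ell_y(f)$, $f$ denotes the polynomial that agrees with $f$ on $\operatorname{dom} f$. Fix the monomial basis $(Z^a)_{a\in\mathbb{N}^{mn}}$. For $y=(y_a)_{a\in\mathbb{N}^{mn},|a|\le2k}$, let $\ell_y$ be the linear functional on $\mathbb{R}[Z]_{2k}$ given by $\ell_y(\sum_a q_aZ^a)=\sum_a q_ay_a$, applied entrywise to vector-valued polynomials. The pseudo-moment cone $\mathscr{R}^k$ is the set of all such $y$ with $\ell_y(\sigma_0)\ge0$ for all $\sigma_0\in\Sigma_k[Z]$ and $\ell_y(g_i\sigma_i)\ge0$ for all $i\in\{1,\dots,s\}$ and all $\sigma_i\in\Sigma_k[Z]$ with $\deg(g_i\sigma_i)\le2k$.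 The moment relaxation of order $k$ is $$f_{\rm mom}^k(X)=\inf\{\ell_y(f):\ y\in\mathscr{R}^k,\ \ell_y(1)=1,\ \ell_y(p)=p(X)\}.$$ For $j\le k$, the moment matrix $M_j(y)$ of order $j$ is the symmetric matrix with entries $\ell_y(Z^{a}Z^{b})$ indexed by $a,b\in\mathbb{N}^{mn}$ with $|a|,|b|\le j$. A vector $y$ is the vector of moments of a measure $\mu$ if $y_a=\int Z^a\,d\mu(Z)$ for all $a$ with $|a|\le2k$.
   Formalization: The formal theorem additionally assumes s ≥ 1 and d_g ≥ 1 (with constant g_i the rank condition is void and the claim fails), and that f has at least one polyconvex minorant (otherwise f_pc is a supremum over the empty set and the equality fails). *)

theory Defs
  imports
    "HOL-Analysis.Analysis"
    "HOL-Library.Poly_Mapping"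
    "Jordan_Normal_Form.DL_Rank"
begin

section \<open>Minors\<close>

text \<open>Real matrices with rows indexed by \<open>'m\<close> and columns indexed by \<open>'n\<close>.\<close>

type_synonym ('m, 'n) rmat = "real^'n^'m"

text \<open>
  The coordinates of \<open>p\<close> are the pairs of a nonempty set of rows and a set of columns of the
  same cardinality. The cardinality of this type is therefore
  \<open>N = (\<Sum>j = 1..min m n. (m choose j) * (n choose j))\<close>, see \<open>card_minor_idx\<close> below.
\<close>

typedef ('m::finite, 'n::finite) minor_idx =
    "{(I :: 'm set, J :: 'n set). I \<noteq> {} \<and> card I = card J}"
  morphisms idx_sets Abs_minor_idx
proof -
  have "({undefined}, {undefined}) \<in> {(I :: 'm set, J :: 'n set). I \<noteq> {} \<and> card I = card J}"
    by simp
  then show ?thesis by blast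
qed

instance minor_idx :: (finite, finite) finite
proof
  have "inj (idx_sets :: ('a, 'b) minor_idx \<Rightarrow> _)"
    by (simp add: inj_on_def idx_sets_inject)
  then show "finite (UNIV :: ('a, 'b) minor_idx set)"
    by (rule finite_imageD[rotated]) simp
qed

lemma card_minor_idx:
  "CARD(('m::finite, 'n::finite) minor_idx) =
    (\<Sum>j = 1..min CARD('m) CARD('n). (CARD('m) choose j) * (CARD('n) choose j))"
proof -
  let ?S = "{(I :: 'm set, J :: 'n set). I \<noteq> {} \<and> card I = card J}"
  let ?T = "\<lambda>j. {I :: 'm set. card I = j} \<times> {J :: 'n set. card J = j}"
  have "CARD(('m, 'n) minor_idx) = card ?S"
    using type_definition.card[OF type_definition_minor_idx] by blast
  also have "?S = (\<Union>j\<in>{1..min CARD('m) CARD('n)}. ?T j)"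
  proof (rule Set.set_eqI, rule iffI)
    fix x assume "x \<in> ?S"
    then obtain I J where x: "x = (I, J)" "I \<noteq> {}" "card I = card J" by auto
    have "1 \<le> card I" using x(2) by (simp add: Suc_le_eq card_gt_0_iff)
    moreover have "card I \<le> CARD('m)" "card J \<le> CARD('n)" by (simp_all add: card_mono)
    ultimately show "x \<in> (\<Union>j\<in>{1..min CARD('m) CARD('n)}. ?T j)" using x by auto
  qed auto
  also have "card \<dots> = (\<Sum>j = 1..min CARD('m) CARD('n). card (?T j))"
    by (rule card_UN_disjoint) auto
  also have "\<dots> = (\<Sum>j = 1..min CARD('m) CARD('n). (CARD('m) choose j) * (CARD('n) choose j))"
    using n_subsets[of "UNIV :: 'm set"] n_subsets[of "UNIV :: 'n set"]
    by (simp add: card_cartesian_product)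
  finally show ?thesis .
qed

text \<open>
  Generic in the ring of entries, so that the same definition yields both the values of the minors
  (entries in \<open>real\<close>) and the minors as polynomials (entries are the indeterminates). Rows and
  columns of the submatrix are taken in increasing order; \<open>Determinant.det\<close> and \<open>Matrix.mat\<close> are
  the determinant and the matrices whose dimensions are numbers rather than types.
\<close>

definition minor :: "('m \<Rightarrow> 'n \<Rightarrow> 'a::comm_ring_1) \<Rightarrow>
    ('m::{finite,linorder}, 'n::{finite,linorder}) minor_idx \<Rightarrow> 'a" where
  "minor A c = (case idx_sets c of (I, J) \<Rightarrow>
     Determinant.det (Matrix.mat (card I) (card J)
       (\<lambda>(i, j). A (sorted_list_of_set I ! i) (sorted_list_of_set J ! j))))"

definition minors :: "('m, 'n) rmat \<Rightarrow> real^('m::{finite,linorder}, 'n::{finite,linorder}) minor_idx"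
  where "minors X = (\<chi> c. minor (\<lambda>i j. X $ i $ j) c)"


section \<open>Polyconvexity\<close>

text \<open>
  Functions with values in \<open>\<real> \<union> {+\<infinity>}\<close> are \<open>ereal\<close>-valued functions that avoid \<open>-\<infinity>\<close>.
  Since \<open>0 * \<infinity> = 0\<close> in \<open>ereal\<close>, the convexity inequality is trivial for \<open>t = 0\<close> and \<open>t = 1\<close>.
\<close>

definition no_minus_inf :: "('a \<Rightarrow> ereal) \<Rightarrow> bool" where
  "no_minus_inf h \<longleftrightarrow> (\<forall>x. h x \<noteq> - \<infinity>)"

definition effdom :: "('a \<Rightarrow> ereal) \<Rightarrow> 'a set" where
  "effdom h = {x. h x < \<infinity>}"

definition convex_ext :: "('a::real_vector \<Rightarrow> ereal) \<Rightarrow> bool" where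
  "convex_ext g \<longleftrightarrow> no_minus_inf g \<and>
     (\<forall>x y. \<forall>t\<in>{0..1}. g ((1 - t) *\<^sub>R x + t *\<^sub>R y) \<le> ereal (1 - t) * g x + ereal t * g y)"

definition polyconvex ::
    "(('m::{finite,linorder}, 'n::{finite,linorder}) rmat \<Rightarrow> ereal) \<Rightarrow> bool" where
  "polyconvex h \<longleftrightarrow> (\<exists>g. convex_ext g \<and> h = g \<circ> minors)"

text \<open>If \<open>f\<close> has no polyconvex minorant, the supremum below is that of the empty set, \<open>-\<infinity>\<close>.\<close>

definition polyconvex_envelope ::
    "(('m::{finite,linorder}, 'n::{finite,linorder}) rmat \<Rightarrow> ereal) \<Rightarrow> ('m, 'n) rmat \<Rightarrow> ereal" where
  "polyconvex_envelope f X = (SUP h\<in>{h. polyconvex h \<and> h \<le> f}. h X)"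


section \<open>Polynomials in the entries of a matrix\<close>

text \<open>A multi-index assigns an exponent to each entry; a polynomial is a finitely supported family
  of coefficients, multiplied by convolution.\<close>

type_synonym ('m, 'n) midx = "('m \<times> 'n) \<Rightarrow>\<^sub>0 nat"
type_synonym ('m, 'n) mpoly = "('m, 'n) midx \<Rightarrow>\<^sub>0 real"

definition midx_deg :: "('m::finite, 'n::finite) midx \<Rightarrow> nat" where
  "midx_deg a = (\<Sum>v\<in>UNIV. Poly_Mapping.lookup a v)"

definition monom_val :: "('m::finite, 'n::finite) midx \<Rightarrow> ('m, 'n) rmat \<Rightarrow> real" where
  "monom_val a Z = (\<Prod>(i, j)\<in>UNIV. (Z $ i $ j) ^ Poly_Mapping.lookup a (i, j))"

definition poly_val :: "('m::finite, 'n::finite) mpoly \<Rightarrow> ('m, 'n) rmat \<Rightarrow> real" where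
  "poly_val q Z = (\<Sum>a\<in>Poly_Mapping.keys q. Poly_Mapping.lookup q a * monom_val a Z)"

definition poly_deg :: "('m::finite, 'n::finite) mpoly \<Rightarrow> nat" where
  "poly_deg q = Max (insert 0 (midx_deg ` Poly_Mapping.keys q))"

definition indet :: "'m \<Rightarrow> 'n \<Rightarrow> ('m, 'n) mpoly" where
  "indet i j = Poly_Mapping.single (Poly_Mapping.single (i, j) 1) 1"

definition minor_poly ::
    "('m::{finite,linorder}, 'n::{finite,linorder}) minor_idx \<Rightarrow> ('m, 'n) mpoly" where
  "minor_poly c = minor indet c"

definition sos_cone :: "nat \<Rightarrow> ('m::finite, 'n::finite) mpoly set" where
  "sos_cone k = {\<Sum>q\<leftarrow>qs. q * q | qs. \<forall>q\<in>set qs. poly_deg q \<le> k}"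


section \<open>The moment relaxation\<close>

definition riesz :: "(('m, 'n) midx \<Rightarrow> real) \<Rightarrow> ('m::finite, 'n::finite) mpoly \<Rightarrow> real" where
  "riesz y q = (\<Sum>a\<in>Poly_Mapping.keys q. Poly_Mapping.lookup q a * y a)"

text \<open>
  A vector indexed by the multi-indices of degree at most \<open>2 * k\<close> is a function on all multi-indices
  that vanishes outside that range.
\<close>

definition trunc_seq :: "nat \<Rightarrow> (('m::finite, 'n::finite) midx \<Rightarrow> real) set" where
  "trunc_seq k = {y. \<forall>a. 2 * k < midx_deg a \<longrightarrow> y a = 0}"

definition pseudo_moment_cone ::
    "nat \<Rightarrow> (nat \<Rightarrow> ('m, 'n) mpoly) \<Rightarrow> nat \<Rightarrow> (('m::finite, 'n::finite) midx \<Rightarrow> real) set" where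
  "pseudo_moment_cone s g k = {y \<in> trunc_seq k.
     (\<forall>\<sigma>\<in>sos_cone k. 0 \<le> riesz y \<sigma>) \<and>
     (\<forall>i\<in>{1..s}. \<forall>\<sigma>\<in>sos_cone k. poly_deg (g i * \<sigma>) \<le> 2 * k \<longrightarrow> 0 \<le> riesz y (g i * \<sigma>))}"

definition mom_feasible ::
    "nat \<Rightarrow> (nat \<Rightarrow> ('m, 'n) mpoly) \<Rightarrow> nat \<Rightarrow> ('m, 'n) rmat \<Rightarrow>
      (('m::{finite,linorder}, 'n::{finite,linorder}) midx \<Rightarrow> real) set" where
  "mom_feasible s g k X = {y \<in> pseudo_moment_cone s g k.
     riesz y 1 = 1 \<and> (\<chi> c. riesz y (minor_poly c)) = minors X}"

text \<open>The objective is a polynomial \<open>q\<close> that agrees with \<open>f\<close> on its effective domain.\<close>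

definition f_mom ::
    "('m::{finite,linorder}, 'n::{finite,linorder}) mpoly \<Rightarrow> nat \<Rightarrow> (nat \<Rightarrow> ('m, 'n) mpoly) \<Rightarrow>
      nat \<Rightarrow> ('m, 'n) rmat \<Rightarrow> ereal" where
  "f_mom q s g k X = (INF y\<in>mom_feasible s g k X. ereal (riesz y q))"

definition mom_optimal ::
    "('m::{finite,linorder}, 'n::{finite,linorder}) mpoly \<Rightarrow> nat \<Rightarrow> (nat \<Rightarrow> ('m, 'n) mpoly) \<Rightarrow>
      nat \<Rightarrow> ('m, 'n) rmat \<Rightarrow> (('m, 'n) midx \<Rightarrow> real) \<Rightarrow> bool" where
  "mom_optimal q s g k X y \<longleftrightarrow>
     y \<in> mom_feasible s g k X \<and> (\<forall>y'\<in>mom_feasible s g k X. riesz y q \<le> riesz y' q)"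


section \<open>Moment matrices and representing measures\<close>

text \<open>The rank of the moment matrix does not depend on the enumeration chosen here.\<close>

definition midx_list :: "nat \<Rightarrow> ('m::finite, 'n::finite) midx list" where
  "midx_list j = (SOME as. distinct as \<and> set as = {a. midx_deg a \<le> j})"

lemma midx_list:
  "distinct (midx_list j :: ('m::finite, 'n::finite) midx list)"
  "set (midx_list j :: ('m, 'n) midx list) = {a. midx_deg a \<le> j}"
proof -
  let ?A = "{a :: ('m, 'n) midx. midx_deg a \<le> j}"
  have "Poly_Mapping.lookup ` ?A \<subseteq> PiE UNIV (\<lambda>_. {..j})"
  proof (clarsimp simp: PiE_iff midx_deg_def)
    fix a :: "('m, 'n) midx" and v w
    assume "sum (Poly_Mapping.lookup a) UNIV \<le> j"
    then show "Poly_Mapping.lookup a (v, w) \<le> j"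
      using member_le_sum[of "(v, w)" UNIV "Poly_Mapping.lookup a"] by simp
  qed
  then have "finite (Poly_Mapping.lookup ` ?A)"
    by (rule finite_subset) (simp add: finite_PiE)
  then have "finite ?A"
    by (rule finite_imageD) (simp add: inj_on_def lookup_inject)
  then have "\<exists>as. distinct as \<and> set as = ?A"
    using finite_distinct_list by blast
  then have "distinct (midx_list j :: ('m, 'n) midx list) \<and> set (midx_list j) = ?A"
    unfolding midx_list_def by (rule someI_ex)
  then show "distinct (midx_list j :: ('m, 'n) midx list)" "set (midx_list j) = ?A" by auto
qed

definition moment_matrix ::
    "nat \<Rightarrow> (('m::finite, 'n::finite) midx \<Rightarrow> real) \<Rightarrow> real Matrix.mat" where
  "moment_matrix j y = (let as = midx_list j :: ('m, 'n) midx list in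
     Matrix.mat (length as) (length as)
       (\<lambda>(i, l). riesz y (Poly_Mapping.single (as ! i) 1 * Poly_Mapping.single (as ! l) 1)))"

definition mat_rank :: "real Matrix.mat \<Rightarrow> nat" where
  "mat_rank A = vec_space.rank (dim_row A) A"

definition atomic_measure_on :: "(('m, 'n) rmat) measure \<Rightarrow> (('m::finite, 'n::finite) rmat) set \<Rightarrow> bool"
  where
  "atomic_measure_on \<mu> S \<longleftrightarrow> finite_measure \<mu> \<and> sets \<mu> = sets borel \<and>
     finite S \<and> (\<forall>Z\<in>S. emeasure \<mu> {Z} > 0) \<and> emeasure \<mu> (- S) = 0"

definition moment_vector_of ::
    "nat \<Rightarrow> (('m, 'n) midx \<Rightarrow> real) \<Rightarrow> (('m::finite, 'n::finite) rmat) measure \<Rightarrow> bool" where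
  "moment_vector_of k y \<mu> \<longleftrightarrow>
     (\<forall>a. midx_deg a \<le> 2 * k \<longrightarrow> integrable \<mu> (monom_val a) \<and> y a = (\<integral>Z. monom_val a Z \<partial>\<mu>))"

end

theory Submission
  imports Defs "HOL-Computational_Algebra.Fundamental_Theorem_Algebra"
begin

text \<open>
  Let \<open>L\<close> be the Riesz functional of the optimal \<open>y\<close> of order \<open>k\<close>, and call a polynomial \<open>p\<close> of
  degree at most \<open>k\<close> null if \<open>L (p * q) = 0\<close> for all \<open>q\<close> of degree at most \<open>k\<close>. Equality of the
  ranks says that every polynomial of degree at most \<open>k\<close> agrees modulo null polynomials with one
  of degree at most \<open>k - d\<close>. Hence multiplication by the entries of \<open>Z\<close> induces commuting
  operators on the finite-dimensional quotient, symmetric for the inner product \<open>L (p * q)\<close>. If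
  \<open>e\<close> is a joint eigenvector with eigenvalues \<open>Z\<close>, then \<open>L (p * e) = p(Z) * L e\<close>, and eigenvectors
  for distinct points are orthogonal, so \<open>e\<close> vanishes at all other joint eigenvalues. These
  points are the atoms, the normalised eigenvectors are interpolation polynomials, and
  \<open>0 \<le> L (g i * e\<^sup>2)\<close> puts the atoms into the effective domain.

  The polyconvex envelope at \<open>X\<close> is the infimum of \<open>v\<close> over the points \<open>(minors X, v)\<close> of the
  convex hull of the graph of \<open>f\<close> over the minors. Each such point is the image of a feasible
  vector of the relaxation, whatever its order, and the optimal atomic measure is such a point.
\<close>

section \<open>Polynomials and the Riesz functional\<close>

abbreviation const_poly :: "real \<Rightarrow> ('m, 'n) mpoly" where
  "const_poly c \<equiv> Poly_Mapping.single 0 c"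

abbreviation monom_poly :: "('m, 'n) midx \<Rightarrow> ('m, 'n) mpoly" where
  "monom_poly a \<equiv> Poly_Mapping.single a 1"

lemma midx_deg_zero [simp]: "midx_deg 0 = 0"
  by (simp add: midx_deg_def)

lemma midx_deg_add: "midx_deg (a + b) = midx_deg a + midx_deg b"
  by (simp add: midx_deg_def lookup_add sum.distrib)

lemma midx_deg_single [simp]: "midx_deg (Poly_Mapping.single v e) = e"
  by (simp add: midx_deg_def lookup_single when_def)

lemma poly_deg_le_iff: "poly_deg p \<le> k \<longleftrightarrow> (\<forall>a\<in>Poly_Mapping.keys p. midx_deg a \<le> k)"
  by (simp add: poly_deg_def)

lemma poly_deg_zero [simp]: "poly_deg 0 = 0"
  by (simp add: poly_deg_def)

lemma poly_deg_add_le: "poly_deg p \<le> k \<Longrightarrow> poly_deg q \<le> k \<Longrightarrow> poly_deg (p + q) \<le> k"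
  unfolding poly_deg_le_iff using keys_add[of p q] by blast

lemma poly_deg_diff_le: "poly_deg p \<le> k \<Longrightarrow> poly_deg q \<le> k \<Longrightarrow> poly_deg (p - q) \<le> k"
  unfolding poly_deg_le_iff using keys_diff[of p q] by blast

lemma poly_deg_sum_le:
  "(\<And>i. i \<in> I \<Longrightarrow> poly_deg (p i) \<le> k) \<Longrightarrow> poly_deg (\<Sum>i\<in>I. p i) \<le> k"
  by (induction I rule: infinite_finite_induct) (auto intro: poly_deg_add_le)

lemma poly_deg_mult_le: "poly_deg p \<le> k \<Longrightarrow> poly_deg q \<le> l \<Longrightarrow> poly_deg (p * q) \<le> k + l"
  unfolding poly_deg_le_iff
  by (force dest: subsetD[OF keys_mult] simp: midx_deg_add intro: add_mono)

lemma poly_deg_single_le: "midx_deg a \<le> k \<Longrightarrow> poly_deg (Poly_Mapping.single a c) \<le> k"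
  by (auto simp: poly_deg_le_iff)

lemma poly_deg_const_mult_le: "poly_deg p \<le> k \<Longrightarrow> poly_deg (const_poly c * p) \<le> k"
  using poly_deg_mult_le[OF poly_deg_single_le, of 0 0 p k c] by simp

lemma poly_expand:
  "p = (\<Sum>a\<in>Poly_Mapping.keys p. Poly_Mapping.single a (Poly_Mapping.lookup p a))"
  by (rule poly_mapping_eqI)
     (auto simp: lookup_sum lookup_single when_def in_keys_iff sum.If_cases)

lemma poly_expand_scaled:
  fixes p :: "('m::finite, 'n::finite) mpoly"
  shows "p = (\<Sum>a\<in>Poly_Mapping.keys p. const_poly (Poly_Mapping.lookup p a) * monom_poly a)"
  using poly_expand[of p] by (simp add: mult_single)

lemma riesz_superset:
  "finite A \<Longrightarrow> Poly_Mapping.keys p \<subseteq> A \<Longrightarrow> riesz y p = (\<Sum>a\<in>A. Poly_Mapping.lookup p a * y a)"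
  unfolding riesz_def by (rule sum.mono_neutral_left) (auto simp: in_keys_iff)

lemma riesz_zero [simp]: "riesz y 0 = 0"
  by (simp add: riesz_def)

lemma riesz_add: "riesz y (p + q) = riesz y p + riesz y q"
proof -
  let ?A = "Poly_Mapping.keys p \<union> Poly_Mapping.keys q"
  have "riesz y (p + q) = (\<Sum>a\<in>?A. Poly_Mapping.lookup (p + q) a * y a)"
    by (rule riesz_superset) (auto dest: subsetD[OF keys_add])
  also have "\<dots> = riesz y p + riesz y q"
    by (subst (1 2) riesz_superset[where A = ?A])
       (auto simp: lookup_add algebra_simps sum.distrib)
  finally show ?thesis .
qed

lemma riesz_uminus: "riesz y (- p) = - riesz y p"
  using riesz_add[of y p "- p"] by simp

lemma riesz_diff: "riesz y (p - q) = riesz y p - riesz y q"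
  using riesz_add[of y p "- q"] by (simp add: riesz_uminus)

lemma riesz_sum: "riesz y (\<Sum>i\<in>I. p i) = (\<Sum>i\<in>I. riesz y (p i))"
  by (induction I rule: infinite_finite_induct) (auto simp: riesz_add)

lemma riesz_single: "riesz y (Poly_Mapping.single a c) = c * y a"
  by (simp add: riesz_def)

lemma riesz_const_mult: "riesz y (const_poly c * p) = c * riesz y p"
  by (subst (1 2) poly_expand)
     (simp add: sum_distrib_left mult_single riesz_sum riesz_single mult.assoc)

lemma riesz_cong: "(\<And>a. a \<in> Poly_Mapping.keys p \<Longrightarrow> y a = z a) \<Longrightarrow> riesz y p = riesz z p"
  by (simp add: riesz_def)

lemma riesz_sum_seq: "riesz (\<lambda>a. \<Sum>i\<in>I. c i * y i a) p = (\<Sum>i\<in>I. c i * riesz (y i) p)"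
  unfolding riesz_def sum_distrib_left by (subst sum.swap) (simp add: mult_ac)

text \<open>Evaluation at \<open>Z\<close> is the Riesz functional of the Dirac measure at
  \<open>Z\<close>, so its linearity is inherited from \<open>riesz\<close>.\<close>

lemma poly_val_eq_riesz: "poly_val p Z = riesz (\<lambda>a. monom_val a Z) p"
  by (simp add: poly_val_def riesz_def)

lemma monom_val_zero [simp]: "monom_val 0 Z = 1"
  by (simp add: monom_val_def)

lemma monom_val_add: "monom_val (a + b) Z = monom_val a Z * monom_val b Z"
  by (simp add: monom_val_def lookup_add power_add prod.distrib case_prod_unfold)

lemma monom_val_single: "monom_val (Poly_Mapping.single (i, j) 1) Z = Z $ i $ j"
proof -
  have "monom_val (Poly_Mapping.single (i, j) 1) Z
      = (\<Prod>v\<in>UNIV. if (i, j) = v then Z $ fst v $ snd v else 1)"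
    unfolding monom_val_def
    by (rule prod.cong) (auto simp: lookup_single when_def split: prod.splits)
  then show ?thesis by simp
qed

lemma poly_val_add: "poly_val (p + q) Z = poly_val p Z + poly_val q Z"
  by (simp add: poly_val_eq_riesz riesz_add)

lemma poly_val_diff: "poly_val (p - q) Z = poly_val p Z - poly_val q Z"
  by (simp add: poly_val_eq_riesz riesz_diff)

lemma poly_val_sum: "poly_val (\<Sum>i\<in>I. p i) Z = (\<Sum>i\<in>I. poly_val (p i) Z)"
  by (simp add: poly_val_eq_riesz riesz_sum)

lemma poly_val_monom_poly [simp]: "poly_val (monom_poly a) Z = monom_val a Z"
  by (simp add: poly_val_eq_riesz riesz_single)

lemma poly_val_mult: "poly_val (p * q) Z = poly_val p Z * poly_val q Z"
  by (subst (1 2 3 4) poly_expand)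
     (simp add: poly_val_eq_riesz sum_product mult_single riesz_sum riesz_single monom_val_add mult_ac)

lemma poly_val_one [simp]: "poly_val 1 Z = 1"
  using poly_val_monom_poly[of 0 Z] by simp

lemma poly_val_zero [simp]: "poly_val 0 Z = 0"
  by (simp add: poly_val_def)

lemma poly_val_const_mult: "poly_val (const_poly c * p) Z = c * poly_val p Z"
  by (simp add: poly_val_eq_riesz riesz_const_mult)

lemma poly_val_indet [simp]: "poly_val (indet i j) Z = Z $ i $ j"
  using poly_val_monom_poly[of "Poly_Mapping.single (i, j) 1" Z] monom_val_single[of i j Z] by (simp add: indet_def)

lemma poly_deg_indet_le: "poly_deg (indet i j) \<le> 1"
  by (simp add: indet_def poly_deg_single_le)

section \<open>Minors as polynomials: values and degrees\<close>

lemma poly_val_prod: "poly_val (\<Prod>i\<in>I. p i) Z = (\<Prod>i\<in>I. poly_val (p i) Z)"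
  by (induction I rule: infinite_finite_induct) (auto simp: poly_val_mult)

lemma poly_deg_one [simp]: "poly_deg 1 = 0"
  using poly_deg_single_le[of 0 0 1] by simp

lemma poly_deg_prod_le:
  "finite I \<Longrightarrow> (\<And>i. i \<in> I \<Longrightarrow> poly_deg (p i) \<le> d i) \<Longrightarrow> poly_deg (\<Prod>i\<in>I. p i) \<le> (\<Sum>i\<in>I. d i)"
  by (induction I rule: finite_induct) (auto intro!: poly_deg_mult_le)

lemma poly_deg_signof_le: "poly_deg (signof p) \<le> 0"
  by (simp add: sign_def poly_deg_diff_le[of 0 0 1, simplified])

lemma poly_val_signof: "poly_val (signof p) Z = signof p"
  using poly_val_diff[of 0 1 Z] by (simp add: sign_def)

lemma poly_val_minor_poly: "poly_val (minor_poly c) Z = minor (\<lambda>i j. Z $ i $ j) c"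
proof -
  obtain I J where IJ: "idx_sets c = (I, J)" by fastforce
  show ?thesis
    by (auto simp: minor_poly_def minor_def IJ Determinant.det_def poly_val_sum poly_val_mult
        poly_val_prod poly_val_signof permutes_in_image intro!: sum.cong prod.cong)
qed

text \<open>In the Leibniz expansion every term is a sign times a product of \<open>card J\<close>
  indeterminates, and \<open>card J = card I\<close>.\<close>

lemma poly_deg_minor_poly_le:
  fixes c :: "('m::{finite,linorder}, 'n::{finite,linorder}) minor_idx"
  shows "poly_deg (minor_poly c) \<le> CARD('m)"
proof -
  obtain I J where IJ: "idx_sets c = (I, J)" by fastforce
  have eq: "card I = card J" using idx_sets[of c] IJ by auto
  have le: "card I \<le> CARD('m)" by (simp add: card_mono)
  let ?A = "Matrix.mat (card J) (card J)
    (\<lambda>(i, j). indet (sorted_list_of_set I ! i) (sorted_list_of_set J ! j)) :: ('m, 'n) mpoly Matrix.mat"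
  have "poly_deg (\<Sum>p | p permutes {0..<card J}. signof p * (\<Prod>i = 0..<card J. ?A $$ (i, p i)))
      \<le> card J"
  proof (rule poly_deg_sum_le)
    fix p assume p: "p \<in> {p. p permutes {0..<card J}}"
    have "poly_deg (\<Prod>i = 0..<card J. ?A $$ (i, p i)) \<le> (\<Sum>i = 0..<card J. 1)"
      by (rule poly_deg_prod_le) (use p in \<open>auto simp: permutes_in_image intro!: poly_deg_indet_le[simplified]\<close>)
    then show "poly_deg (signof p * (\<Prod>i = 0..<card J. ?A $$ (i, p i))) \<le> card J"
      using poly_deg_mult_le[OF poly_deg_signof_le, of _ "card J" p] by simp
  qed
  then have "poly_deg (minor_poly c) \<le> card J"
    by (simp add: minor_poly_def minor_def IJ Determinant.det_def eq)
  with le eq show ?thesis by simp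
qed

section \<open>Column rank\<close>

text \<open>Gaussian elimination: there are more vectors \<open>v j\<close> than coordinates
  \<open>s\<close>. Each induction step removes one coordinate, using a vector with a nonzero entry
  there as pivot. The coordinates will be multi-indices in one use and atoms in another.\<close>

lemma exists_linear_relation:
  fixes v :: "'j \<Rightarrow> 'a \<Rightarrow> real"
  assumes "finite S" "finite J" "card S < card J"
  shows "\<exists>d. (\<exists>j\<in>J. d j \<noteq> 0) \<and> (\<forall>s\<in>S. (\<Sum>j\<in>J. d j * v j s) = 0)"
  using assms
proof (induction S arbitrary: J v rule: finite_induct)
  case empty
  then obtain j where "j \<in> J" by fastforce
  then show ?case by (intro exI[of _ "\<lambda>_. 1"]) auto
next
  case (insert s S)
  show ?case
  proof (cases "\<forall>j\<in>J. v j s = 0")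
    case True
    obtain d where "\<exists>j\<in>J. d j \<noteq> 0" "\<forall>s\<in>S. (\<Sum>j\<in>J. d j * v j s) = 0"
      using insert.IH[of J v] insert.prems insert.hyps by auto
    with True show ?thesis by (intro exI[of _ d]) auto
  next
    case False
    then obtain i where i: "i \<in> J" "v i s \<noteq> 0" by blast
    let ?J = "J - {i}"
    have "card S < card ?J" "finite ?J" using insert i by auto
    then obtain d where d: "\<exists>j\<in>?J. d j \<noteq> 0"
      "\<forall>t\<in>S. (\<Sum>j\<in>?J. d j * (v j t - v j s / v i s * v i t)) = 0"
      using insert.IH[of ?J "\<lambda>j t. v j t - v j s / v i s * v i t"] by auto
    \<comment> \<open>The coefficient of the pivot is chosen to make the coordinate \<open>s\<close>
      of the combination vanish.\<close>
    define e where "e = d(i := - (\<Sum>j\<in>?J. d j * v j s) / v i s)"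
    have split: "(\<Sum>j\<in>J. e j * v j t) = e i * v i t + (\<Sum>j\<in>?J. d j * v j t)" for t
      by (subst sum.remove[OF \<open>finite J\<close> i(1)]) (auto simp: e_def intro!: sum.cong)
    have "(\<Sum>j\<in>J. e j * v j t) = 0" if "t \<in> insert s S" for t
    proof (cases "t = s")
      case True
      have "e i = - (\<Sum>j\<in>?J. d j * v j s) / v i s" by (simp add: e_def)
      then show ?thesis using i True by (simp only: split) simp
    next
      case False
      then have "(\<Sum>j\<in>?J. d j * (v j t - v j s / v i s * v i t)) = 0" using d that by blast
      then have "(\<Sum>j\<in>?J. d j * v j t) = (\<Sum>j\<in>?J. d j * v j s) / v i s * v i t"
        unfolding sum_divide_distrib sum_distrib_right
        by (simp add: right_diff_distrib sum_subtractf mult.assoc)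
      moreover have "e i = - (\<Sum>j\<in>?J. d j * v j s) / v i s" by (simp add: e_def)
      ultimately show ?thesis by (simp add: split)
    qed
    moreover have "\<exists>j\<in>J. e j \<noteq> 0" using d by (auto simp: e_def)
    ultimately show ?thesis by blast
  qed
qed

text \<open>Independence of an indexed family, so equal columns at different indices count as
  dependent. The row set \<open>B\<close> is explicit because it is enlarged later.\<close>

definition indep_columns :: "'b set \<Rightarrow> ('b \<Rightarrow> 'a \<Rightarrow> real) \<Rightarrow> 'a set \<Rightarrow> bool" where
  "indep_columns B F S \<longleftrightarrow>
     (\<forall>c. (\<forall>b\<in>B. (\<Sum>a\<in>S. c a * F b a) = 0) \<longrightarrow> (\<forall>a\<in>S. c a = 0))"

context
  fixes as :: "'a list" and F :: "'a \<Rightarrow> 'a \<Rightarrow> real"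
begin

interpretation vec_space "TYPE(real)" "length as" .

private definition column :: "'a \<Rightarrow> real Matrix.vec" where
  "column a = Matrix.vec (length as) (\<lambda>i. F (as ! i) a)"

private definition M :: "real Matrix.mat" where
  "M = Matrix.mat (length as) (length as) (\<lambda>(i, l). F (as ! i) (as ! l))"

private lemma M_carrier: "M \<in> carrier_mat (length as) (length as)"
  by (simp add: M_def)

private lemma set_cols: "set (cols M) = column ` set as"
proof -
  have "cols M = map column as"
    by (rule nth_equalityI) (auto simp: M_def column_def)
  then show ?thesis by simp
qed

private lemma column_carrier [simp]: "column a \<in> carrier_vec (length as)"
  by (simp add: column_def)

private lemma columns_carrier: "column ` S \<subseteq> carrier_vec (length as)"
  by auto

private lemma lincomb_column:
  assumes "inj_on column S" "finite S" "i < length as"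
  shows "lincomb c (column ` S) $ i = (\<Sum>a\<in>S. c (column a) * F (as ! i) a)"
proof -
  have "column a $ i = F (as ! i) a" for a
    using assms(3) by (simp add: column_def)
  then show ?thesis
    using lincomb_index[OF assms(3) columns_carrier, of c S] assms(1) by (simp add: sum.reindex)
qed

private lemma indep_columns_imp_inj:
  assumes "indep_columns (set as) F S" "finite S"
  shows "inj_on column S"
proof (rule inj_onI, rule ccontr)
  fix a b assume ab: "a \<in> S" "b \<in> S" "column a = column b" "a \<noteq> b"
  have eq: "F (as ! i) a = F (as ! i) b" if "i < length as" for i
    using arg_cong[OF ab(3), of "\<lambda>v. v $ i"] that by (simp add: column_def)
  define c :: "'a \<Rightarrow> real" where "c x = (if x = a then 1 else if x = b then - 1 else 0)" for x
  have "\<forall>b'\<in>set as. (\<Sum>x\<in>S. c x * F b' x) = 0"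
  proof
    fix b' assume "b' \<in> set as"
    then obtain i where i: "i < length as" "b' = as ! i" by (auto simp: in_set_conv_nth)
    have "(\<Sum>x\<in>S. c x * F b' x) = (\<Sum>x\<in>{a, b}. c x * F b' x)"
      using ab \<open>finite S\<close> by (intro sum.mono_neutral_right) (auto simp: c_def)
    then show "(\<Sum>x\<in>S. c x * F b' x) = 0" using ab eq[OF i(1)] i by (simp add: c_def)
  qed
  then have "c a = 0" using assms(1) ab(1) unfolding indep_columns_def by blast
  then show False by (simp add: c_def)
qed

text \<open>\<open>lin_indpt\<close> concerns a set of vectors, in which equal columns would merge;
  injectivity makes it comparable with the indexed notion.\<close>

private lemma lin_indpt_columns_iff:
  assumes "inj_on column S" "finite S"
  shows "lin_indpt (column ` S) \<longleftrightarrow> indep_columns (set as) F S"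
proof
  assume ind: "lin_indpt (column ` S)"
  show "indep_columns (set as) F S"
    unfolding indep_columns_def
  proof (intro allI impI ballI)
    fix c a assume c: "\<forall>b\<in>set as. (\<Sum>a\<in>S. c a * F b a) = 0" and a: "a \<in> S"
    let ?c = "\<lambda>v. c (inv_into S column v)"
    have inv: "?c (column x) = c x" if "x \<in> S" for x
      using that assms by (simp add: inv_into_f_f)
    have "lincomb ?c (column ` S) = 0\<^sub>v (length as)"
    proof (rule eq_vecI)
      fix i assume "i < dim_vec (0\<^sub>v (length as))"
      then show "lincomb ?c (column ` S) $ i = 0\<^sub>v (length as) $ i"
        using c assms by (simp add: lincomb_column inv)
    qed (use assms columns_carrier in \<open>simp add: lincomb_dim\<close>)
    then have "\<not> ?c (column a) \<noteq> 0"
      using ind a assms(2) unfolding lin_dep_def by blast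
    then show "c a = 0" using inv[OF a] by simp
  qed
next
  assume ind: "indep_columns (set as) F S"
  show "lin_indpt (column ` S)"
  proof (rule finite_lin_indpt2)
    fix c assume z: "lincomb c (column ` S) = 0\<^sub>v (length as)"
    have "(\<Sum>a\<in>S. c (column a) * F b a) = 0" if b: "b \<in> set as" for b
    proof -
      obtain i where i: "i < length as" "b = as ! i" using b by (auto simp: in_set_conv_nth)
      then show ?thesis using lincomb_column[OF assms i(1), of c] z by simp
    qed
    then show "\<forall>v\<in>column ` S. c v = 0"
      using ind[unfolded indep_columns_def, rule_format, of "\<lambda>a. c (column a)"] by blast
  qed (use assms in auto)
qed

text \<open>A maximal independent set of columns has as many elements as the rank; one index is
  chosen for each of its columns.\<close>

lemma exists_indep_columns_rank:
  "\<exists>S\<subseteq>set as. card S = mat_rank (Matrix.mat (length as) (length as) (\<lambda>(i, l). F (as ! i) (as ! l)))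
     \<and> indep_columns (set as) F S"
proof -
  have "lin_indpt {}" by (auto simp: lin_dep_def)
  then obtain T where T: "maximal T (\<lambda>T. T \<subseteq> set (cols M) \<and> lin_indpt T)"
    using maximal_exists_superset[of "set (cols M)" "\<lambda>T. T \<subseteq> set (cols M) \<and> lin_indpt T" "{}"]
    by auto
  have rank: "rank M = card T" using rank_card_indpt[OF M_carrier T] .
  have "T \<subseteq> column ` set as" "lin_indpt T"
    using T unfolding maximal_def set_cols by auto
  then obtain S where S: "S \<subseteq> set as" "inj_on column S" "T = column ` S"
    by (meson subset_image_inj)
  have "finite S" using S finite_subset by blast
  then show ?thesis
    using S rank \<open>lin_indpt T\<close> lin_indpt_columns_iff[OF S(2)]
    by (intro exI[of _ S]) (auto simp: mat_rank_def M_def card_image)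
qed

text \<open>Otherwise the column of \<open>x\<close> could be added to the independent ones, giving
  more independent columns than the rank.\<close>

lemma indep_columns_rank_span:
  assumes S: "S \<subseteq> set as" and ind: "indep_columns (set as) F S"
    and rank: "mat_rank (Matrix.mat (length as) (length as) (\<lambda>(i, l). F (as ! i) (as ! l))) \<le> card S"
    and x: "x \<in> set as"
  shows "\<exists>c. \<forall>b\<in>set as. F b x = (\<Sum>a\<in>S. c a * F b a)"
proof -
  have fin: "finite S" using S finite_subset by blast
  have inj: "inj_on column S" by (rule indep_columns_imp_inj[OF ind fin])
  have li: "lin_indpt (column ` S)" using lin_indpt_columns_iff[OF inj fin] ind by simp
  have "column x \<in> span (column ` S)"
  proof (rule ccontr)
    assume x': "column x \<notin> span (column ` S)"
    then have notin: "column x \<notin> column ` S"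
      using span_mem[OF columns_carrier] by blast
    then have "lin_indpt (column ` S \<union> {column x})"
      using lin_dep_iff_in_span[OF columns_carrier li column_carrier notin] x' by blast
    moreover have "column ` S \<union> {column x} \<subseteq> set (cols M)" using S x by (auto simp: set_cols)
    ultimately have "card (column ` S \<union> {column x}) \<le> rank M"
      by (intro rank_ge_card_indpt[OF M_carrier]) auto
    moreover have "card (column ` S \<union> {column x}) = Suc (card S)"
      using fin inj notin by (simp add: card_image)
    ultimately show False using rank by (simp add: mat_rank_def M_def)
  qed
  then obtain c where c: "lincomb c (column ` S) = column x"
    using finite_in_span[OF finite_imageI[OF fin] columns_carrier] by blast
  have "F b x = (\<Sum>a\<in>S. c (column a) * F b a)" if b: "b \<in> set as" for b
  proof -
    obtain i where i: "i < length as" "b = as ! i" using b by (auto simp: in_set_conv_nth)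
    then show ?thesis
      using lincomb_column[OF inj fin i(1), of c] arg_cong[OF c, of "\<lambda>v. v $ i"]
      by (simp add: column_def)
  qed
  then show ?thesis by (intro exI[of _ "\<lambda>a. c (column a)"]) blast
qed

end

section \<open>Flat functionals and their atoms\<close>

lemma map_poly_of_real_add: "map_poly of_real (p + q) = map_poly of_real p + map_poly of_real q"
  by (rule poly_eqI) (simp add: coeff_map_poly)

lemma map_poly_of_real_mult:
  fixes p q :: "real poly"
  shows "map_poly of_real (p * q) =
    (map_poly of_real p * map_poly of_real q :: 'a::{comm_semiring_1,real_algebra_1} poly)"
  by (rule poly_eqI) (simp add: coeff_map_poly coeff_mult)

lemma midx_split_single:
  fixes a :: "('m::finite, 'n::finite) midx"
  assumes "a \<noteq> 0"
  obtains v b where "a = Poly_Mapping.single v 1 + b" "midx_deg a = Suc (midx_deg b)"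
proof -
  obtain v where v: "Poly_Mapping.lookup a v \<noteq> 0"
    using assms by (auto simp: poly_mapping_eq_iff fun_eq_iff)
  have "a = Poly_Mapping.single v 1 + (a - Poly_Mapping.single v 1)"
    using v by (intro poly_mapping_eqI) (auto simp: lookup_add lookup_minus lookup_single when_def)
  moreover from this have "midx_deg a = midx_deg (Poly_Mapping.single v 1) + midx_deg (a - Poly_Mapping.single v 1)"
    by (metis midx_deg_add)
  ultimately show ?thesis using that by simp
qed

text \<open>At most \<open>i\<close> single variables are moved to the first factor. With
  \<open>i = j = k\<close> this turns every moment up to degree \<open>2 * k\<close> into a value of
  the form \<open>L (p * q)\<close>.\<close>

lemma midx_split_degree:
  fixes a :: "('m::finite, 'n::finite) midx"
  assumes "midx_deg a \<le> i + j"
  shows "\<exists>b c. a = b + c \<and> midx_deg b \<le> i \<and> midx_deg c \<le> j"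
  using assms
proof (induction i arbitrary: a)
  case 0
  then show ?case by (intro exI[of _ 0] exI[of _ a]) auto
next
  case (Suc i)
  show ?case
  proof (cases "a = 0")
    case True
    then show ?thesis by (intro exI[of _ 0] exI[of _ a]) auto
  next
    case False
    then obtain v b where vb: "a = Poly_Mapping.single v 1 + b" "midx_deg a = Suc (midx_deg b)"
      by (rule midx_split_single)
    then obtain b' c where "b = b' + c" "midx_deg b' \<le> i" "midx_deg c \<le> j"
      using Suc.IH[of b] Suc.prems by auto
    then show ?thesis
      using vb by (intro exI[of _ "Poly_Mapping.single v 1 + b'"] exI[of _ c])
        (auto simp: midx_deg_add add.assoc)
  qed
qed

lemma single_sum: "Poly_Mapping.single a (\<Sum>i\<in>I. c i) = (\<Sum>i\<in>I. Poly_Mapping.single a (c i))"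
  by (induction I rule: infinite_finite_induct) (auto simp: single_add)

text \<open>The monomials with exponents in \<open>S\<close> form a basis of the polynomials of degree at most \<open>k\<close>
  modulo the null polynomials.\<close>

locale flat_functional =
  fixes y :: "('m::finite, 'n::finite) midx \<Rightarrow> real" and k d :: nat and S :: "('m, 'n) midx set"
  assumes d_pos: "1 \<le> d" and d_le: "d \<le> k"
    and psd: "poly_deg p \<le> k \<Longrightarrow> 0 \<le> riesz y (p * p)"
    and S_sub: "S \<subseteq> {a. midx_deg a \<le> k - d}" and fin_S: "finite S"
    and S_span: "midx_deg a \<le> k \<Longrightarrow>
      \<exists>c. \<forall>b. midx_deg b \<le> k \<longrightarrow> y (a + b) = (\<Sum>s\<in>S. c s * y (s + b))"
    and S_indep: "\<forall>b. midx_deg b \<le> k \<longrightarrow> (\<Sum>s\<in>S. c s * y (s + b)) = 0 \<Longrightarrow> s \<in> S \<Longrightarrow> c s = 0"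
begin

section \<open>Null polynomials and the finite-dimensional quotient\<close>

abbreviation L :: "('m, 'n) mpoly \<Rightarrow> real" where
  "L \<equiv> riesz y"

text \<open>The coefficient vectors of these polynomials form the kernel of the moment matrix of
  order \<open>k\<close>.\<close>

definition null :: "('m, 'n) mpoly \<Rightarrow> bool" where
  "null p \<longleftrightarrow> poly_deg p \<le> k \<and> (\<forall>q. poly_deg q \<le> k \<longrightarrow> L (p * q) = 0)"

lemma nullD: "null p \<Longrightarrow> poly_deg q \<le> k \<Longrightarrow> L (p * q) = 0"
  by (simp add: null_def)

lemma null_zero [simp]: "null 0"
  by (simp add: null_def)

lemma null_add: "null p \<Longrightarrow> null q \<Longrightarrow> null (p + q)"
  by (simp add: null_def poly_deg_add_le distrib_right riesz_add)

lemma null_const_mult: "null p \<Longrightarrow> null (const_poly c * p)"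
  by (simp add: null_def poly_deg_const_mult_le mult.assoc riesz_const_mult)

lemma null_diff: "null p \<Longrightarrow> null q \<Longrightarrow> null (p - q)"
  by (simp add: null_def poly_deg_diff_le left_diff_distrib riesz_diff)

lemma null_sum: "(\<And>i. i \<in> I \<Longrightarrow> null (p i)) \<Longrightarrow> null (\<Sum>i\<in>I. p i)"
  by (induction I rule: infinite_finite_induct) (auto intro: null_add)

lemma null_monomI:
  assumes "poly_deg p \<le> k" "\<And>b. midx_deg b \<le> k \<Longrightarrow> L (p * monom_poly b) = 0"
  shows "null p"
  unfolding null_def
proof (intro conjI allI impI)
  fix q :: "('m, 'n) mpoly" assume q: "poly_deg q \<le> k"
  have "L (p * q) = L (\<Sum>b\<in>Poly_Mapping.keys q. const_poly (Poly_Mapping.lookup q b) * (p * monom_poly b))"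
    by (subst poly_expand_scaled[of q]) (simp add: sum_distrib_left mult_ac)
  also have "\<dots> = 0"
    using assms(2) q unfolding poly_deg_le_iff by (simp add: riesz_sum riesz_const_mult)
  finally show "L (p * q) = 0" .
qed (rule assms)

lemma deg_le_k: "poly_deg p \<le> k - d \<Longrightarrow> poly_deg p \<le> k"
  by simp

text \<open>Here \<open>1 \<le> d\<close> matters: a polynomial of degree at most
  \<open>k - d\<close> can be multiplied by an entry without exceeding degree
  \<open>k\<close>.\<close>

lemma deg_mult_le_k: "poly_deg x \<le> 1 \<Longrightarrow> poly_deg p \<le> k - d \<Longrightarrow> poly_deg (x * p) \<le> k"
  using poly_deg_mult_le[of x 1 p "k - d"] d_pos d_le by simp

lemma exists_span_coeffs:
  assumes "poly_deg p \<le> k"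
  shows "\<exists>c. null (p - (\<Sum>s\<in>S. const_poly (c s) * monom_poly s))"
proof -
  let ?K = "Poly_Mapping.keys p"
  have "\<forall>a\<in>?K. \<exists>c. \<forall>b. midx_deg b \<le> k \<longrightarrow> y (a + b) = (\<Sum>s\<in>S. c s * y (s + b))"
    using assms S_span unfolding poly_deg_le_iff by blast
  from bchoice[OF this] obtain C where
    C: "\<forall>a\<in>?K. \<forall>b. midx_deg b \<le> k \<longrightarrow> y (a + b) = (\<Sum>s\<in>S. C a s * y (s + b))" ..
  define c where "c s = (\<Sum>a\<in>?K. Poly_Mapping.lookup p a * C a s)" for s
  have "null (p - (\<Sum>s\<in>S. const_poly (c s) * monom_poly s))"
  proof (rule null_monomI)
    show "poly_deg (p - (\<Sum>s\<in>S. const_poly (c s) * monom_poly s)) \<le> k"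
      using S_sub assms
      by (intro poly_deg_diff_le poly_deg_sum_le poly_deg_const_mult_le poly_deg_single_le) auto
    fix b :: "('m, 'n) midx" assume b: "midx_deg b \<le> k"
    have "L (p * monom_poly b) = (\<Sum>a\<in>?K. Poly_Mapping.lookup p a * y (a + b))"
      by (subst poly_expand[of p]) (simp add: sum_distrib_right mult_single riesz_sum riesz_single)
    also have "\<dots> = (\<Sum>a\<in>?K. \<Sum>s\<in>S. Poly_Mapping.lookup p a * (C a s * y (s + b)))"
      using C b by (simp add: sum_distrib_left)
    also have "\<dots> = (\<Sum>s\<in>S. c s * y (s + b))"
      unfolding c_def sum_distrib_right by (subst sum.swap) (simp add: mult.assoc)
    also have "\<dots> = L ((\<Sum>s\<in>S. const_poly (c s) * monom_poly s) * monom_poly b)"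
      by (simp add: sum_distrib_right mult_single riesz_sum riesz_single)
    finally show "L ((p - (\<Sum>s\<in>S. const_poly (c s) * monom_poly s)) * monom_poly b) = 0"
      by (simp add: left_diff_distrib riesz_diff)
  qed
  then show ?thesis by blast
qed

text \<open>Flatness in polynomial form: the spanning monomials have exponents in \<open>S\<close>,
  hence degree at most \<open>k - d\<close>.\<close>

lemma exists_reduced:
  assumes "poly_deg p \<le> k"
  shows "\<exists>p'. poly_deg p' \<le> k - d \<and> null (p' - p)"
proof -
  obtain c where c: "null (p - (\<Sum>s\<in>S. const_poly (c s) * monom_poly s))"
    using exists_span_coeffs[OF assms] by blast
  have "null (0 - (p - (\<Sum>s\<in>S. const_poly (c s) * monom_poly s)))"
    by (rule null_diff[OF null_zero c])
  then have "null ((\<Sum>s\<in>S. const_poly (c s) * monom_poly s) - p)" by simp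
  moreover have "poly_deg (\<Sum>s\<in>S. const_poly (c s) * monom_poly s) \<le> k - d"
    using S_sub by (intro poly_deg_sum_le poly_deg_const_mult_le poly_deg_single_le) auto
  ultimately show ?thesis by blast
qed

text \<open>The quotient by the null polynomials has dimension at most
  \<open>card S\<close>.\<close>

lemma exists_null_combination:
  assumes "finite J" "card S < card J" "\<And>j. j \<in> J \<Longrightarrow> poly_deg (p j) \<le> k"
  shows "\<exists>c. (\<exists>j\<in>J. c j \<noteq> 0) \<and> null (\<Sum>j\<in>J. const_poly (c j) * p j)"
proof -
  have "\<forall>j\<in>J. \<exists>v. null (p j - (\<Sum>s\<in>S. const_poly (v s) * monom_poly s))"
    using assms exists_span_coeffs by blast
  from bchoice[OF this] obtain v where
    v: "\<forall>j\<in>J. null (p j - (\<Sum>s\<in>S. const_poly (v j s) * monom_poly s))" ..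
  obtain c where c: "\<exists>j\<in>J. c j \<noteq> 0" "\<And>s. s \<in> S \<Longrightarrow> (\<Sum>j\<in>J. c j * v j s) = 0"
    using exists_linear_relation[OF fin_S assms(1,2), of v] by blast
  have "(\<Sum>j\<in>J. const_poly (c j) * (\<Sum>s\<in>S. const_poly (v j s) * monom_poly s))
      = (\<Sum>s\<in>S. const_poly (\<Sum>j\<in>J. c j * v j s) * monom_poly s)"
    unfolding sum_distrib_left single_sum sum_distrib_right
    by (subst sum.swap) (simp add: mult_single)
  also have "\<dots> = 0" using c by simp
  finally have "(\<Sum>j\<in>J. const_poly (c j) * p j)
      = (\<Sum>j\<in>J. const_poly (c j) * (p j - (\<Sum>s\<in>S. const_poly (v j s) * monom_poly s)))"
    by (simp add: right_diff_distrib sum_subtractf)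
  also have "null \<dots>" using v by (intro null_sum null_const_mult) simp
  finally show ?thesis using c by blast
qed

text \<open>Cauchy-Schwarz for the semidefinite form \<open>L (p * q)\<close>: if
  \<open>L (p * p) = 0\<close> but \<open>L (p * q) \<noteq> 0\<close>, then \<open>L\<close> is
  negative on the square of \<open>p + t * q\<close> for a suitable number \<open>t\<close>.\<close>

lemma null_iff_square:
  assumes "poly_deg p \<le> k"
  shows "null p \<longleftrightarrow> L (p * p) = 0"
proof
  assume pp: "L (p * p) = 0"
  have "L (p * q) = 0" if q: "poly_deg q \<le> k" for q
  proof (rule ccontr)
    assume ne: "L (p * q) \<noteq> 0"
    define B C where "B = L (p * q)" and "C = L (q * q)"
    have C: "0 \<le> C" using psd[OF q] by (simp add: C_def)
    have "0 \<le> 2 * t * B + t\<^sup>2 * C" for t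
    proof -
      have const: "const_poly (2 * t) = const_poly t + const_poly t"
        "const_poly (t\<^sup>2) = const_poly t * const_poly t"
        by (simp_all add: mult_single power2_eq_square flip: single_add)
      have "(p + const_poly t * q) * (p + const_poly t * q)
          = p * p + const_poly (2 * t) * (p * q) + const_poly (t\<^sup>2) * (q * q)"
        unfolding const by (simp add: algebra_simps)
      then have "L ((p + const_poly t * q) * (p + const_poly t * q)) = 2 * t * B + t\<^sup>2 * C"
        by (simp add: riesz_add riesz_const_mult pp B_def C_def)
      moreover have "0 \<le> L ((p + const_poly t * q) * (p + const_poly t * q))"
        by (intro psd poly_deg_add_le poly_deg_const_mult_le assms q)
      ultimately show ?thesis by simp
    qed
    \<comment> \<open>The parabola has its vertex at \<open>- B / C\<close>; adding 1 to the
      denominator also covers \<open>C = 0\<close>.\<close>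
    define u where "u = B / (C + 1)"
    have u: "B = u * (C + 1)" "u \<noteq> 0" using C ne by (auto simp: u_def B_def)
    from \<open>0 \<le> 2 * (- u) * B + (- u)\<^sup>2 * C\<close> have "u\<^sup>2 * (C + 2) \<le> 0"
      by (simp add: u(1) power2_eq_square algebra_simps)
    moreover have "0 < u\<^sup>2 * (C + 2)" using C u by simp
    ultimately show False by simp
  qed
  then show "null p" using assms by (simp add: null_def)
qed (use assms in \<open>simp add: null_def\<close>)

text \<open>Any test polynomial differs from a reduced one by a null polynomial. Reduced ones can
  still be multiplied by an entry, which the commutation argument below requires.\<close>

lemma null_if_orthogonal_reduced:
  assumes "poly_deg p \<le> k" "\<And>q. poly_deg q \<le> k - d \<Longrightarrow> L (p * q) = 0"
  shows "null p"
  unfolding null_def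
proof (intro conjI allI impI)
  fix q :: "('m, 'n) mpoly" assume q: "poly_deg q \<le> k"
  obtain q' where q': "poly_deg q' \<le> k - d" "null (q' - q)" using exists_reduced[OF q] by blast
  have "p * q = p * q' - (q' - q) * p"
    by (simp add: algebra_simps)
  then have "L (p * q) = L (p * q') - L ((q' - q) * p)"
    by (simp add: riesz_diff)
  with assms(2)[OF q'(1)] show "L (p * q) = 0" using nullD[OF q'(2) assms(1)] by simp
qed (rule assms)

text \<open>Invariance is modulo null polynomials: \<open>x * p\<close> itself may exceed degree
  \<open>k - d\<close>, so a representative \<open>p'\<close> in \<open>V\<close> stands for
  it.\<close>

definition invariant_subspace :: "('m, 'n) mpoly \<Rightarrow> ('m, 'n) mpoly set \<Rightarrow> bool" where
  "invariant_subspace x V \<longleftrightarrow> (\<forall>p\<in>V. poly_deg p \<le> k - d) \<and>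
     (\<forall>p\<in>V. \<forall>q\<in>V. p + q \<in> V) \<and> (\<forall>p\<in>V. \<forall>c. const_poly c * p \<in> V) \<and>
     (\<forall>p\<in>V. \<exists>p'\<in>V. null (p' - x * p))"

lemma invariant_subspaceD:
  assumes "invariant_subspace x V" "p \<in> V"
  shows "poly_deg p \<le> k - d" "q \<in> V \<Longrightarrow> p + q \<in> V" "const_poly c * p \<in> V"
    "\<exists>p'\<in>V. null (p' - x * p)"
  using assms by (auto simp: invariant_subspace_def)

text \<open>The empty sum is excluded because \<open>V\<close> may be empty and then lacks
  0.\<close>

lemma invariant_subspace_sum:
  assumes "invariant_subspace x V" "finite I" "I \<noteq> {}" "\<And>i. i \<in> I \<Longrightarrow> p i \<in> V"
  shows "(\<Sum>i\<in>I. p i) \<in> V"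
  using assms(2-4)
  by (induction I rule: finite_ne_induct) (auto intro: invariant_subspaceD(2)[OF assms(1)])

text \<open>
  Take a univariate polynomial \<open>P\<close> of least degree with \<open>P(T) e\<close> null, where \<open>T\<close> is multiplication
  by \<open>x\<close>. If \<open>P = (t - a) * Q\<close>, then \<open>Q(T) e\<close> is an eigenvector. A quadratic factor
  \<open>(t - a)\<^sup>2 + b\<^sup>2\<close> with \<open>b \<noteq> 0\<close> is impossible: with \<open>e' = Q(T) e\<close> and \<open>f = (T - a) e'\<close>, symmetry of
  \<open>T\<close> gives \<open>L (f * f) + b\<^sup>2 * L (e' * e') = 0\<close>.
\<close>

lemma exists_eigenvector:
  assumes V: "invariant_subspace x V" and x: "poly_deg x \<le> 1"
    and e: "e \<in> V" "\<not> null e"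
  shows "\<exists>e'\<in>V. \<exists>r. \<not> null e' \<and> null (x * e' - const_poly r * e')"
proof -
  from bchoice[of V "\<lambda>p p'. p' \<in> V \<and> null (p' - x * p)"] obtain T
    where T: "\<forall>p\<in>V. T p \<in> V \<and> null (T p - x * p)"
    using invariant_subspaceD(4)[OF V] by blast
  \<comment> \<open>\<open>E\<close> is the Krylov sequence of \<open>e\<close>, and
    \<open>act P\<close> below represents \<open>P(T) e\<close>. It is linear in \<open>P\<close>,
    and \<open>pCons 0\<close> corresponds to multiplication by \<open>x\<close> modulo null
    polynomials.\<close>
  define E where "E j = (T ^^ j) e" for j
  have E_V: "E j \<in> V" for j
    by (induction j) (use e T in \<open>auto simp: E_def\<close>)
  have E_Suc: "null (E (Suc j) - x * E j)" for j
    using T E_V[of j] by (simp add: E_def)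
  define act :: "real poly \<Rightarrow> ('m, 'n) mpoly" where
    "act P = (\<Sum>j\<le>degree P. const_poly (Polynomial.coeff P j) * E j)" for P
  have act_upto: "act P = (\<Sum>j\<le>n. const_poly (Polynomial.coeff P j) * E j)" if "degree P \<le> n" for P n
    unfolding act_def using that
    by (intro sum.mono_neutral_left) (auto simp: coeff_eq_0)
  have act_V: "act P \<in> V" for P
    unfolding act_def
    by (intro invariant_subspace_sum[OF V] invariant_subspaceD(3)[OF V] E_V) auto
  have act_add: "act (P + Q) = act P + act Q" for P Q
  proof -
    have "degree (P + Q) \<le> max (degree P) (degree Q)" by (rule degree_add_le_max)
    then show ?thesis
      using act_upto[of _ "max (degree P) (degree Q)"]
      by (simp add: single_add distrib_right sum.distrib)
  qed
  have act_smult: "act (Polynomial.smult c P) = const_poly c * act P" for c P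
    using act_upto[of "Polynomial.smult c P" "degree P"]
    by (simp add: act_def sum_distrib_left mult_single flip: mult.assoc)
  have act_shift: "null (act (pCons 0 P) - x * act P)" for P
  proof -
    have "act (pCons 0 P) = (\<Sum>j\<le>Suc (degree P). const_poly (Polynomial.coeff (pCons 0 P) j) * E j)"
      by (rule act_upto) (simp add: degree_pCons_le)
    also have "\<dots> = (\<Sum>j\<le>degree P. const_poly (Polynomial.coeff P j) * E (Suc j))"
      by (subst sum.atMost_Suc_shift) simp
    finally have "act (pCons 0 P) - x * act P
        = (\<Sum>j\<le>degree P. const_poly (Polynomial.coeff P j) * (E (Suc j) - x * E j))"
      by (simp add: act_def sum_distrib_left sum_subtractf right_diff_distrib mult_ac)
    then show ?thesis using E_Suc by (auto intro!: null_sum null_const_mult)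
  qed
  have act_linear: "null (act ([:- a, 1:] * P) - (x * act P - const_poly a * act P))" for a P
  proof -
    have "[:- a, 1:] * P = pCons 0 P + Polynomial.smult (- a) P" by simp
    then have "act ([:- a, 1:] * P) = act (pCons 0 P) + const_poly (- a) * act P"
      by (simp only: act_add act_smult)
    also have "\<dots> = act (pCons 0 P) - const_poly a * act P"
      by (simp add: single_uminus)
    finally show ?thesis using act_shift[of P] by (simp add: algebra_simps)
  qed
  define bad where "bad P \<longleftrightarrow> P \<noteq> 0 \<and> null (act P)" for P
  \<comment> \<open>The \<open>card S + 1\<close> polynomials \<open>E 0\<close>, ...,
    \<open>E (card S)\<close> exceed the dimension of the quotient.\<close>
  have "\<exists>P. bad P"
  proof -
    obtain c where c: "\<exists>j\<in>{..card S}. c j \<noteq> 0" "null (\<Sum>j\<in>{..card S}. const_poly (c j) * E j)"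
      using exists_null_combination[of "{..card S}" E] invariant_subspaceD(1)[OF V E_V] deg_le_k
      by auto
    define P where "P = (\<Sum>j\<le>card S. Polynomial.monom (c j) j)"
    have coeff: "Polynomial.coeff P j = (if j \<le> card S then c j else 0)" for j
      by (simp add: P_def coeff_sum if_distrib sum.If_cases sum.delta cong: if_cong)
    have "degree P \<le> card S" by (rule degree_le) (simp add: coeff)
    then have "act P = (\<Sum>j\<in>{..card S}. const_poly (c j) * E j)"
      by (simp add: act_upto coeff)
    moreover have "P \<noteq> 0" using c(1) coeff by (metis atMost_iff coeff_0)
    ultimately show ?thesis using c(2) by (auto simp: bad_def)
  qed
  then obtain P where P: "bad P" "\<And>Q. bad Q \<Longrightarrow> degree P \<le> degree Q"
    using ex_has_least_nat[of bad _ degree] by metis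
  have factor_good: "\<not> null (act Q)" if "P = D * Q" "0 < degree D" for D Q
  proof
    assume "null (act Q)"
    moreover have "Q \<noteq> 0" "D \<noteq> 0" using P(1) that by (auto simp: bad_def)
    ultimately show False
      using P(2)[of Q] that by (simp add: bad_def degree_mult_eq)
  qed
  have "degree P \<noteq> 0"
  proof
    assume "degree P = 0"
    then obtain c where c: "P = [:c:]" by (rule degree_eq_zeroE)
    then have "c \<noteq> 0" "null (const_poly c * e)"
      using P(1) by (auto simp: bad_def act_def E_def)
    then have "null (const_poly (1 / c) * (const_poly c * e))" "c \<noteq> 0"
      by (auto intro: null_const_mult)
    then show False using e by (simp add: mult_single flip: mult.assoc)
  qed
  then have "\<not> constant (poly (map_poly complex_of_real P))"
    by (simp add: constant_degree degree_map_poly)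
  then obtain z where z: "poly (map_poly complex_of_real P) z = 0"
    using fundamental_theorem_of_algebra by blast
  show ?thesis
  proof (cases "Im z = 0")
    case True
    then have "z = complex_of_real (Re z)" by (simp add: complex_eq_iff)
    moreover have "poly (map_poly complex_of_real P) (complex_of_real t) = of_real (poly P t)" for t
      by (simp add: poly_altdef degree_map_poly coeff_map_poly)
    ultimately have "poly P (Re z) = 0" using z by (metis of_real_eq_0_iff)
    then have "[:- Re z, 1:] dvd P" by (simp add: poly_eq_0_iff_dvd)
    then obtain Q where Q: "P = [:- Re z, 1:] * Q" by (rule dvdE)
    have "null (act P - (act P - (x * act Q - const_poly (Re z) * act Q)))"
      using P(1) null_diff[OF _ act_linear[of "Re z" Q]] unfolding Q[symmetric] bad_def by blast
    then have "null (x * act Q - const_poly (Re z) * act Q)" by simp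
    with act_V factor_good[OF Q] show ?thesis by auto
  next
    case False
    define a b where "a = Re z" and "b = Im z"
    \<comment> \<open>\<open>D\<close> is the real quadratic with roots \<open>z\<close> and its
      conjugate. The remainder of \<open>P\<close> modulo \<open>D\<close> is real of degree at most
      1 and vanishes at the nonreal \<open>z\<close>, so it is 0.\<close>
    define D where "D = [:- a, 1:] * [:- a, 1:] + [:b\<^sup>2:]"
    have D_eq: "D = [:a\<^sup>2 + b\<^sup>2, - 2 * a, 1:]" by (simp add: D_def power2_eq_square)
    have D_z: "poly (map_poly complex_of_real D) z = 0"
      by (simp add: D_eq complex_eq_iff a_def b_def power2_eq_square map_poly_pCons algebra_simps)
    have "degree (P mod D) < 2"
      using degree_mod_less[of D P] by (auto simp: D_eq)
    then have "P mod D = [:Polynomial.coeff (P mod D) 0, Polynomial.coeff (P mod D) 1:]"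
      by (intro poly_eqI) (auto simp: coeff_pCons coeff_eq_0 split: nat.splits)
    then obtain r0 r1 where R: "P mod D = [:r0, r1:]" by blast
    have "poly (map_poly complex_of_real (P mod D)) z = 0"
    proof -
      have "map_poly complex_of_real P
          = map_poly complex_of_real (P div D) * map_poly complex_of_real D
            + map_poly complex_of_real (P mod D)"
        by (metis div_mult_mod_eq map_poly_of_real_add map_poly_of_real_mult)
      then show ?thesis using z D_z by simp
    qed
    then have "r1 * Im z = 0" "r0 + r1 * Re z = 0"
      by (auto simp: R complex_eq_iff map_poly_pCons mult.commute)
    then have "P mod D = 0" using False by (simp add: R)
    then obtain Q where Q: "P = D * Q" by (metis dvd_def mod_0_imp_dvd)
    have e': "\<not> null (act Q)" using factor_good[OF Q] by (simp add: D_eq)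
    define f where "f = act ([:- a, 1:] * Q)"
    have "[:b\<^sup>2:] * Q = Polynomial.smult (b\<^sup>2) Q" by simp
    then have "P = [:- a, 1:] * ([:- a, 1:] * Q) + Polynomial.smult (b\<^sup>2) Q"
      by (simp only: Q D_def distrib_right mult.assoc)
    then have "act P = act ([:- a, 1:] * ([:- a, 1:] * Q)) + const_poly (b\<^sup>2) * act Q"
      by (simp only: act_add act_smult)
    then have "null ((x * f - const_poly a * f) + const_poly (b\<^sup>2) * act Q)"
      using null_diff[OF _ act_linear[of a "[:- a, 1:] * Q"], of "act P"] P(1)
      by (simp add: f_def bad_def algebra_simps)
    then have "L (((x * f - const_poly a * f) + const_poly (b\<^sup>2) * act Q) * act Q) = 0"
      by (rule nullD) (rule deg_le_k[OF invariant_subspaceD(1)[OF V act_V]])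
    \<comment> \<open>Symmetry of \<open>T\<close>: the factor \<open>x - a\<close> moves from
      \<open>f\<close> to \<open>act Q\<close>, where it yields \<open>f\<close> again up to a null
      polynomial.\<close>
    moreover have "((x * f - const_poly a * f) + const_poly (b\<^sup>2) * act Q) * act Q
        = f * f - (f - (x * act Q - const_poly a * act Q)) * f + const_poly (b\<^sup>2) * (act Q * act Q)"
      by (simp add: algebra_simps)
    moreover have "L ((f - (x * act Q - const_poly a * act Q)) * f) = 0"
      using act_linear[of a Q] deg_le_k[OF invariant_subspaceD(1)[OF V act_V]]
      unfolding f_def by (blast intro: nullD)
    ultimately have "L (f * f) + b\<^sup>2 * L (act Q * act Q) = 0"
      by (simp add: riesz_add riesz_diff riesz_const_mult)
    moreover have "0 \<le> L (f * f)" "0 \<le> L (act Q * act Q)"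
      unfolding f_def by (intro psd deg_le_k invariant_subspaceD(1)[OF V act_V])+
    ultimately have "L (act Q * act Q) = 0"
      using False by (auto simp: b_def add_nonneg_eq_0_iff)
    then have "null (act Q)"
      using null_iff_square deg_le_k[OF invariant_subspaceD(1)[OF V act_V]] by blast
    with e' show ?thesis by blast
  qed
qed

section \<open>Joint eigenvectors of all entries\<close>

abbreviation entry :: "'m \<times> 'n \<Rightarrow> ('m, 'n) mpoly" where
  "entry v \<equiv> indet (fst v) (snd v)"

text \<open>Induction on the entries: the joint eigenspace \<open>W\<close> of those already treated
  is invariant under the next one because multiplications commute, so it contains an eigenvector of
  the next one too.\<close>

lemma exists_joint_eigenvector:
  assumes "finite I" and V: "\<And>v. invariant_subspace (entry v) V"
    and e: "e \<in> V" "\<not> null e"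
  shows "\<exists>e'\<in>V. \<exists>r. \<not> null e' \<and> (\<forall>v\<in>I. null (entry v * e' - const_poly (r v) * e'))"
  using assms(1)
proof (induction I rule: finite_induct)
  case empty
  with e show ?case by blast
next
  case (insert v I)
  then obtain e' r where e': "e' \<in> V" "\<not> null e'"
    and r: "\<forall>u\<in>I. null (entry u * e' - const_poly (r u) * e')" by blast
  define W where "W = {p \<in> V. \<forall>u\<in>I. null (entry u * p - const_poly (r u) * p)}"
  have deg: "poly_deg p \<le> k - d" if "p \<in> V" for p
    using invariant_subspaceD(1)[OF V that] .
  have "invariant_subspace (entry v) W"
    unfolding invariant_subspace_def
  proof (intro conjI ballI allI)
    fix p q assume pq: "p \<in> W" "q \<in> W"
    have "entry u * (p + q) - const_poly (r u) * (p + q)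
        = (entry u * p - const_poly (r u) * p) + (entry u * q - const_poly (r u) * q)" for u
      by (simp add: algebra_simps)
    then show "p + q \<in> W"
      using pq null_add invariant_subspaceD(2)[OF V] unfolding W_def by auto
  next
    fix p c assume p: "p \<in> W"
    have "entry u * (const_poly c * p) - const_poly (r u) * (const_poly c * p)
        = const_poly c * (entry u * p - const_poly (r u) * p)" for u
      by (simp add: algebra_simps)
    then show "const_poly c * p \<in> W"
      using p null_const_mult invariant_subspaceD(3)[OF V] unfolding W_def by auto
  next
    fix p assume p: "p \<in> W"
    then have "p \<in> V" by (simp add: W_def)
    then obtain p' where p': "p' \<in> V" "null (p' - entry v * p)"
      using invariant_subspaceD(4)[OF V] by blast
    \<comment> \<open>Commutation is tested against reduced \<open>q\<close>. Then
      \<open>entry u * q\<close> and \<open>entry v * q\<close> have degree at most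
      \<open>k\<close>, so they are admissible tests for the null polynomials
      \<open>p' - entry v * p\<close> and \<open>entry u * p - const_poly (r u) * p\<close>.\<close>
    have "null (entry u * p' - const_poly (r u) * p')" if u: "u \<in> I" for u
    proof (rule null_if_orthogonal_reduced)
      show "poly_deg (entry u * p' - const_poly (r u) * p') \<le> k"
        using deg[OF p'(1)]
        by (intro poly_deg_diff_le deg_mult_le_k poly_deg_indet_le poly_deg_const_mult_le) auto
      fix q :: "('m, 'n) mpoly" assume q: "poly_deg q \<le> k - d"
      have uq: "poly_deg (entry u * q) \<le> k" and vq: "poly_deg (entry v * q) \<le> k"
        by (intro deg_mult_le_k poly_deg_indet_le q)+
      have "null (entry u * p - const_poly (r u) * p)" using p u by (simp add: W_def)
      then have "L ((entry u * p - const_poly (r u) * p) * (entry v * q)) = 0"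
        using vq by (rule nullD)
      moreover have "L ((p' - entry v * p) * (entry u * q)) = 0"
        "L ((p' - entry v * p) * q) = 0"
        using p'(2) uq deg_le_k[OF q] by (auto intro: nullD)
      moreover have "(entry u * p' - const_poly (r u) * p') * q
          = (p' - entry v * p) * (entry u * q) - const_poly (r u) * ((p' - entry v * p) * q)
            + (entry u * p - const_poly (r u) * p) * (entry v * q)"
        by (simp add: algebra_simps)
      ultimately show "L ((entry u * p' - const_poly (r u) * p') * q) = 0"
        by (simp add: riesz_add riesz_diff riesz_const_mult)
    qed
    with p' show "\<exists>p'\<in>W. null (p' - entry v * p)" by (auto simp: W_def)
  qed (auto simp: W_def deg)
  moreover have "e' \<in> W" using e' r by (simp add: W_def)
  ultimately obtain e'' t where "e'' \<in> W" "\<not> null e''" "null (entry v * e'' - const_poly t * e'')"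
    using exists_eigenvector[OF _ poly_deg_indet_le] e'(2) by blast
  then show ?case
    using insert.hyps by (intro bexI[of _ e''] exI[of _ "r(v := t)"]) (auto simp: W_def)
qed

definition eigenpair :: "('m, 'n) rmat \<Rightarrow> ('m, 'n) mpoly \<Rightarrow> bool" where
  "eigenpair Z e \<longleftrightarrow> poly_deg e \<le> k - d \<and> \<not> null e \<and>
     (\<forall>i j. null (indet i j * e - const_poly (Z $ i $ j) * e))"

lemma eigenpair_deg: "eigenpair Z e \<Longrightarrow> poly_deg e \<le> k"
  using deg_le_k by (auto simp: eigenpair_def)

lemma eigenpair_entry:
  assumes "eigenpair Z e" "poly_deg q \<le> k"
  shows "L (indet i j * (e * q)) = Z $ i $ j * L (e * q)"
proof -
  have "L ((indet i j * e - const_poly (Z $ i $ j) * e) * q) = 0"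
    using assms by (auto simp: eigenpair_def intro: nullD)
  then show ?thesis by (simp add: left_diff_distrib riesz_diff riesz_const_mult mult.assoc)
qed

text \<open>The variables of the monomial are split off one by one and replaced by their
  eigenvalues.\<close>

lemma eigenpair_monom:
  assumes e: "eigenpair Z e"
  shows "midx_deg a \<le> k \<Longrightarrow> L (monom_poly a * e) = monom_val a Z * L e"
proof (induction "midx_deg a" arbitrary: a)
  case 0
  then have "a = 0"
    by (metis midx_split_single nat.distinct(1))
  then show ?case by simp
next
  case (Suc l)
  then have "a \<noteq> 0" by auto
  then obtain v b where vb: "a = Poly_Mapping.single v 1 + b" "midx_deg a = Suc (midx_deg b)"
    by (rule midx_split_single)
  obtain i j where v: "v = (i, j)" by (cases v)
  have "monom_poly a * e = indet i j * (e * monom_poly b)"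
    by (simp add: vb v indet_def mult_single mult_ac add.commute)
  then have "L (monom_poly a * e) = Z $ i $ j * L (monom_poly b * e)"
    using eigenpair_entry[OF e, of "monom_poly b" i j] poly_deg_single_le[of b k 1] Suc.prems vb
    by (simp add: mult.commute)
  also have "L (monom_poly b * e) = monom_val b Z * L e"
    using Suc vb by auto
  finally show ?case
    using monom_val_single[of i j Z] by (simp add: vb v monom_val_add)
qed

lemma eigenpair_eval:
  assumes e: "eigenpair Z e" and p: "poly_deg p \<le> k"
  shows "L (p * e) = poly_val p Z * L e"
proof -
  have "L (p * e) = (\<Sum>a\<in>Poly_Mapping.keys p. Poly_Mapping.lookup p a * L (monom_poly a * e))"
    by (subst poly_expand_scaled[of p])
       (simp add: sum_distrib_right riesz_sum riesz_const_mult mult.assoc)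
  also have "\<dots> = poly_val p Z * L e"
    using p eigenpair_monom[OF e] unfolding poly_deg_le_iff
    by (simp add: poly_val_def sum_distrib_right mult.assoc)
  finally show ?thesis .
qed

text \<open>\<open>L (e * e)\<close> is positive since \<open>e\<close> is not null, and
  \<open>eigenpair_eval\<close> factors it as \<open>poly_val e Z * L e\<close>.\<close>

lemma eigenpair_nonzero:
  assumes e: "eigenpair Z e"
  shows "L (e * e) > 0" "L e \<noteq> 0" "poly_val e Z \<noteq> 0"
proof -
  have "L (e * e) \<noteq> 0"
    using e null_iff_square[OF eigenpair_deg[OF e]] by (auto simp: eigenpair_def)
  with psd[OF eigenpair_deg[OF e]] show "L (e * e) > 0" by simp
  then show "L e \<noteq> 0" "poly_val e Z \<noteq> 0"
    using eigenpair_eval[OF e eigenpair_deg[OF e]] by auto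
qed

text \<open>An entry in which \<open>Z\<close> and \<open>Z'\<close> differ can act on either factor
  of \<open>e * e'\<close>, which multiplies the same number by two different eigenvalues.\<close>

lemma eigenpair_orthogonal:
  assumes e: "eigenpair Z e" and e': "eigenpair Z' e'" and "Z \<noteq> Z'"
  shows "L (e * e') = 0"
proof -
  obtain i :: 'm and j :: 'n where ij: "Z $ i $ j \<noteq> Z' $ i $ j" using \<open>Z \<noteq> Z'\<close> by (auto simp: Finite_Cartesian_Product.vec_eq_iff)
  have "Z $ i $ j * L (e * e') = Z' $ i $ j * L (e' * e)"
    using eigenpair_entry[OF e eigenpair_deg[OF e'], of i j]
      eigenpair_entry[OF e' eigenpair_deg[OF e], of i j] by (simp add: mult.commute)
  with ij show ?thesis by (simp add: mult.commute)
qed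

lemma eigenpair_eval_other:
  assumes "eigenpair Z e" "eigenpair Z' e'" "Z \<noteq> Z'"
  shows "poly_val e Z' = 0"
  using eigenpair_orthogonal[OF assms] eigenpair_eval[OF assms(2) eigenpair_deg[OF assms(1)]]
    eigenpair_nonzero[OF assms(2)] by simp

section \<open>The finite set of joint eigenvalues\<close>

definition atoms :: "('m, 'n) rmat set" where
  "atoms = {Z. \<exists>e. eigenpair Z e}"

definition eigvec :: "('m, 'n) rmat \<Rightarrow> ('m, 'n) mpoly" where
  "eigvec Z = (SOME e. eigenpair Z e)"

lemma eigenpair_eigvec: "Z \<in> atoms \<Longrightarrow> eigenpair Z (eigvec Z)"
  unfolding atoms_def eigvec_def by (auto intro: someI_ex)

text \<open>Eigenvectors of distinct points are orthogonal with positive squares, hence independent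
  modulo null polynomials.\<close>

lemma card_atoms_subset_le:
  assumes F: "F \<subseteq> atoms" "finite F"
  shows "card F \<le> card S"
proof (rule ccontr)
  assume "\<not> card F \<le> card S"
  then obtain c where c: "\<exists>Z\<in>F. c Z \<noteq> 0" "null (\<Sum>Z\<in>F. const_poly (c Z) * eigvec Z)"
    using exists_null_combination[of F eigvec] F eigenpair_eigvec eigenpair_deg by force
  then obtain Z where Z: "Z \<in> F" "c Z \<noteq> 0" by blast
  then have eZ: "eigenpair Z (eigvec Z)" using F eigenpair_eigvec by blast
  have "0 = L ((\<Sum>Z\<in>F. const_poly (c Z) * eigvec Z) * eigvec Z)"
    using nullD[OF c(2) eigenpair_deg[OF eZ]] by simp
  also have "\<dots> = (\<Sum>Z'\<in>F. c Z' * L (eigvec Z' * eigvec Z))"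
    by (simp add: sum_distrib_right riesz_sum riesz_const_mult mult.assoc)
  also have "\<dots> = (\<Sum>Z'\<in>{Z}. c Z' * L (eigvec Z' * eigvec Z))"
  proof (intro sum.mono_neutral_right ballI)
    fix Z' assume "Z' \<in> F - {Z}"
    then have "L (eigvec Z' * eigvec Z) = 0"
      using F eigenpair_orthogonal[OF eigenpair_eigvec eZ] by blast
    then show "c Z' * L (eigvec Z' * eigvec Z) = 0" by simp
  qed (use F Z in auto)
  also have "\<dots> = c Z * L (eigvec Z * eigvec Z)" by simp
  finally show False using Z eigenpair_nonzero(1)[OF eZ] by simp
qed

lemma finite_atoms: "finite atoms"
proof (rule ccontr)
  assume "infinite atoms"
  then obtain F where "F \<subseteq> atoms" "finite F" "card F = Suc (card S)"
    by (metis infinite_arbitrarily_large)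
  then show False using card_atoms_subset_le[of F] by simp
qed

text \<open>
  The reduced polynomials that vanish on the atoms form an invariant subspace. A joint eigenvector
  in it would vanish at its own eigenvalue, which is an atom, contradicting \<open>eigenpair_nonzero\<close>.
\<close>

lemma null_if_vanishes_on_atoms:
  assumes p: "poly_deg p \<le> k" and zero: "\<And>Z. Z \<in> atoms \<Longrightarrow> poly_val p Z = 0"
  shows "null p"
proof (rule ccontr)
  assume np: "\<not> null p"
  \<comment> \<open>By \<open>eigenpair_eval\<close>, orthogonality to \<open>eigvec Z\<close> means
    vanishing at \<open>Z\<close>; in this form the condition is insensitive to null
    polynomials.\<close>
  define V where "V = {q. poly_deg q \<le> k - d \<and> (\<forall>Z\<in>atoms. L (q * eigvec Z) = 0)}"
  have inv: "invariant_subspace (entry v) V" for v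
    unfolding invariant_subspace_def
  proof (intro conjI ballI allI)
    fix q assume q: "q \<in> V"
    have "poly_deg (entry v * q) \<le> k"
      using q by (intro deg_mult_le_k poly_deg_indet_le) (simp add: V_def)
    then obtain q' where q': "poly_deg q' \<le> k - d" "null (q' - entry v * q)"
      using exists_reduced by blast
    have "L (q' * eigvec Z) = 0" if Z: "Z \<in> atoms" for Z
    proof -
      have eZ: "eigenpair Z (eigvec Z)" by (rule eigenpair_eigvec[OF Z])
      have "L ((q' - entry v * q) * eigvec Z) = 0"
        using q'(2) eigenpair_deg[OF eZ] by (rule nullD)
      moreover have "L (entry v * (eigvec Z * q)) = 0"
        using eigenpair_entry[OF eZ, of q "fst v" "snd v"] q Z deg_le_k[of q]
        by (simp add: V_def mult.commute)
      moreover have "q' * eigvec Z = (q' - entry v * q) * eigvec Z + entry v * (eigvec Z * q)"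
        by (simp add: algebra_simps)
      ultimately show ?thesis by (simp add: riesz_add)
    qed
    with q' show "\<exists>q'\<in>V. null (q' - entry v * q)" by (auto simp: V_def)
  qed (auto simp: V_def poly_deg_add_le poly_deg_const_mult_le distrib_right riesz_add
      riesz_const_mult mult.assoc)
  obtain p' where p': "poly_deg p' \<le> k - d" "null (p' - p)" using exists_reduced[OF p] by blast
  have "p' \<in> V"
  proof -
    have "L (p' * eigvec Z) = 0" if Z: "Z \<in> atoms" for Z
    proof -
      have eZ: "eigenpair Z (eigvec Z)" by (rule eigenpair_eigvec[OF Z])
      have "L ((p' - p) * eigvec Z) = 0" using p'(2) eigenpair_deg[OF eZ] by (rule nullD)
      then show ?thesis
        using eigenpair_eval[OF eZ p] zero[OF Z] by (simp add: left_diff_distrib riesz_diff)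
    qed
    with p' show ?thesis by (simp add: V_def)
  qed
  moreover have "\<not> null p'"
    using null_diff[of p' "p' - p"] p'(2) np by auto
  ultimately obtain e r where e: "e \<in> V" "\<not> null e"
    "\<forall>v. null (entry v * e - const_poly (r v) * e)"
    using exists_joint_eigenvector[OF finite[of UNIV] inv, of p'] by auto
  define Z :: "('m, 'n) rmat" where "Z = (\<chi> i j. r (i, j))"
  have "eigenpair Z e"
    unfolding eigenpair_def
  proof (intro conjI allI)
    fix i j show "null (indet i j * e - const_poly (Z $ i $ j) * e)"
      using e(3)[rule_format, of "(i, j)"] by (simp add: Z_def)
  qed (use e in \<open>auto simp: V_def\<close>)
  moreover from this have Z: "Z \<in> atoms" by (auto simp: atoms_def)
  moreover have "L (e * eigvec Z) = 0" using e Z by (simp add: V_def)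
  ultimately show False
    using eigenpair_eval[OF eigenpair_eigvec[OF Z] eigenpair_deg[of Z e]]
      eigenpair_nonzero[OF eigenpair_eigvec[OF Z]] eigenpair_nonzero[of Z e] by auto
qed

section \<open>Interpolation polynomials, weights and the quadrature formula\<close>

definition interp :: "('m, 'n) rmat \<Rightarrow> ('m, 'n) mpoly" where
  "interp Z = const_poly (1 / poly_val (eigvec Z) Z) * eigvec Z"

text \<open>The mass of the atom \<open>Z\<close>. At atoms it equals \<open>L (interp Z)\<close>,
  but the square makes its positivity visible.\<close>

definition weight :: "('m, 'n) rmat \<Rightarrow> real" where
  "weight Z = L (interp Z * interp Z)"

lemma interp_deg: "Z \<in> atoms \<Longrightarrow> poly_deg (interp Z) \<le> k - d"
  using eigenpair_eigvec[of Z] by (simp add: interp_def eigenpair_def poly_deg_const_mult_le)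

lemma interp_eval:
  "Z \<in> atoms \<Longrightarrow> Z' \<in> atoms \<Longrightarrow> poly_val (interp Z) Z' = (if Z' = Z then 1 else 0)"
  using eigenpair_nonzero(3)[of Z "eigvec Z"] eigenpair_eval_other[of Z "eigvec Z" Z' "eigvec Z'"]
    eigenpair_eigvec
  by (auto simp: interp_def poly_val_const_mult)

lemma weight_pos:
  assumes "Z \<in> atoms"
  shows "0 < weight Z"
proof -
  let ?c = "1 / poly_val (eigvec Z) Z"
  have e: "eigenpair Z (eigvec Z)" by (rule eigenpair_eigvec[OF assms])
  have "interp Z * interp Z = const_poly ?c * (const_poly ?c * (eigvec Z * eigvec Z))"
    by (simp only: interp_def mult_ac)
  then have "weight Z = ?c * (?c * L (eigvec Z * eigvec Z))"
    by (simp only: weight_def riesz_const_mult)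
  moreover have "0 < ?c * ?c" using eigenpair_nonzero(3)[OF e] by (auto simp: zero_less_mult_iff)
  ultimately show ?thesis using eigenpair_nonzero(1)[OF e] by (metis mult.assoc mult_pos_pos)
qed

text \<open>\<open>eigenpair_eval\<close> gives a multiple of \<open>poly_val q Z\<close>; inserting
  \<open>interp Z\<close>, which is 1 at \<open>Z\<close>, identifies the factor as
  \<open>weight Z\<close>.\<close>

lemma L_interp:
  assumes Z: "Z \<in> atoms" and q: "poly_deg q \<le> k"
  shows "L (interp Z * q) = weight Z * poly_val q Z"
proof -
  have e: "eigenpair Z (eigvec Z)" by (rule eigenpair_eigvec[OF Z])
  have val: "L (interp Z * p) = poly_val p Z * (1 / poly_val (eigvec Z) Z * L (eigvec Z))"
    if "poly_deg p \<le> k" for p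
    using eigenpair_eval[OF e that]
    by (simp add: interp_def riesz_const_mult mult.assoc mult.commute[of "eigvec Z"])
  have "poly_val (interp Z) Z = 1" using interp_eval[OF Z Z] by simp
  then have "weight Z = 1 / poly_val (eigvec Z) Z * L (eigvec Z)"
    using val[OF deg_le_k[OF interp_deg[OF Z]]] by (simp add: weight_def)
  then show ?thesis using val[OF q] by simp
qed

text \<open>The Lagrange interpolant of \<open>p\<close> at the atoms differs from \<open>p\<close>
  by a polynomial vanishing there, hence by a null one.\<close>

lemma L_mult_eq_sum:
  assumes p: "poly_deg p \<le> k" and q: "poly_deg q \<le> k"
  shows "L (p * q) = (\<Sum>Z\<in>atoms. weight Z * (poly_val p Z * poly_val q Z))"
proof -
  let ?p = "\<Sum>Z\<in>atoms. const_poly (poly_val p Z) * interp Z"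
  have "null (p - ?p)"
  proof (rule null_if_vanishes_on_atoms)
    show "poly_deg (p - ?p) \<le> k"
      by (intro poly_deg_diff_le p poly_deg_sum_le poly_deg_const_mult_le deg_le_k interp_deg)
    fix Z assume Z: "Z \<in> atoms"
    have "poly_val ?p Z = (\<Sum>Z'\<in>atoms. poly_val p Z' * (if Z = Z' then 1 else 0))"
      by (simp add: poly_val_sum poly_val_const_mult interp_eval Z cong: sum.cong)
    also have "\<dots> = poly_val p Z" using finite_atoms Z by (simp add: if_distrib cong: if_cong)
    finally show "poly_val (p - ?p) Z = 0" by (simp add: poly_val_diff)
  qed
  from nullD[OF this q] have "L (p * q) = L (?p * q)"
    by (simp add: left_diff_distrib riesz_diff)
  also have "\<dots> = (\<Sum>Z\<in>atoms. poly_val p Z * L (interp Z * q))"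
    by (simp add: sum_distrib_right riesz_sum riesz_const_mult mult.assoc)
  also have "\<dots> = (\<Sum>Z\<in>atoms. weight Z * (poly_val p Z * poly_val q Z))"
    using L_interp[OF _ q] by (intro sum.cong) auto
  finally show ?thesis .
qed

lemma moment_eq_sum:
  assumes "midx_deg a \<le> 2 * k"
  shows "y a = (\<Sum>Z\<in>atoms. weight Z * monom_val a Z)"
proof -
  obtain b c where bc: "a = b + c" "midx_deg b \<le> k" "midx_deg c \<le> k"
    using midx_split_degree[of a k k] assms by auto
  have "y a = L (monom_poly b * monom_poly c)"
    by (simp add: mult_single riesz_single bc)
  also have "\<dots> = (\<Sum>Z\<in>atoms. weight Z * (monom_val b Z * monom_val c Z))"
    using L_mult_eq_sum[of "monom_poly b" "monom_poly c"] bc by (simp add: poly_deg_single_le)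
  finally show ?thesis by (simp add: bc monom_val_add)
qed

lemma L_eq_sum:
  assumes "poly_deg p \<le> 2 * k"
  shows "L p = (\<Sum>Z\<in>atoms. weight Z * poly_val p Z)"
proof -
  have "L p = riesz (\<lambda>a. \<Sum>Z\<in>atoms. weight Z * monom_val a Z) p"
    using assms moment_eq_sum unfolding poly_deg_le_iff by (intro riesz_cong) auto
  then show ?thesis by (simp add: riesz_sum_seq poly_val_eq_riesz)
qed

text \<open>With fewer atoms than elements of \<open>S\<close>, a nontrivial combination of the
  monomials in \<open>S\<close> would vanish at all atoms and, by \<open>moment_eq_sum\<close>,
  contradict \<open>S_indep\<close>.\<close>

lemma card_atoms: "card atoms = card S"
proof (rule antisym)
  show "card atoms \<le> card S" by (rule card_atoms_subset_le[OF subset_refl finite_atoms])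
  show "card S \<le> card atoms"
  proof (rule ccontr)
    assume "\<not> card S \<le> card atoms"
    then obtain c where c: "\<exists>s\<in>S. c s \<noteq> 0" "\<forall>Z\<in>atoms. (\<Sum>s\<in>S. c s * monom_val s Z) = 0"
      using exists_linear_relation[OF finite_atoms fin_S, of monom_val] by auto
    have "(\<Sum>s\<in>S. c s * y (s + b)) = 0" if b: "midx_deg b \<le> k" for b
    proof -
      have "(\<Sum>s\<in>S. c s * y (s + b))
          = (\<Sum>s\<in>S. c s * (\<Sum>Z\<in>atoms. weight Z * (monom_val s Z * monom_val b Z)))"
      proof (rule sum.cong[OF refl])
        fix s assume "s \<in> S"
        then have "midx_deg s \<le> k" using S_sub by auto
        then have "midx_deg (s + b) \<le> 2 * k" using b by (simp add: midx_deg_add)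
        then show "c s * y (s + b) = c s * (\<Sum>Z\<in>atoms. weight Z * (monom_val s Z * monom_val b Z))"
          by (simp add: moment_eq_sum monom_val_add)
      qed
      also have "\<dots> = (\<Sum>Z\<in>atoms. weight Z * monom_val b Z * (\<Sum>s\<in>S. c s * monom_val s Z))"
        unfolding sum_distrib_left by (subst sum.swap) (simp add: mult_ac)
      also have "\<dots> = 0" using c by simp
      finally show ?thesis .
    qed
    then have "\<forall>s\<in>S. c s = 0" using S_indep[of c] by blast
    then show False using c by blast
  qed
qed

end

section \<open>Polyconvex envelope and convex hull of the graph\<close>

definition graph_hull :: "('a \<Rightarrow> 'b::real_vector) \<Rightarrow> ('a \<Rightarrow> real) \<Rightarrow> 'a set \<Rightarrow> ('b \<times> real) set" where
  "graph_hull \<pi> \<phi> D = convex hull ((\<lambda>Z. (\<pi> Z, \<phi> Z)) ` D)"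

text \<open>The lower boundary of the hull; where no point of it lies over \<open>P\<close>, the
  empty infimum gives \<open>\<infinity>\<close>.\<close>

definition hull_fun :: "('a \<Rightarrow> 'b::real_vector) \<Rightarrow> ('a \<Rightarrow> real) \<Rightarrow> 'a set \<Rightarrow> 'b \<Rightarrow> ereal" where
  "hull_fun \<pi> \<phi> D P = (INF v\<in>{v. (P, v) \<in> graph_hull \<pi> \<phi> D}. ereal v)"

lemma convex_epigraph:
  assumes "convex_ext g"
  shows "convex {(P, v). g P \<le> ereal v}"
  unfolding convex_alt
proof (clarsimp)
  fix P v P' v' and t :: real
  assume le: "g P \<le> ereal v" "g P' \<le> ereal v'" and t: "0 \<le> t" "t \<le> 1"
  have "g ((1 - t) *\<^sub>R P + t *\<^sub>R P') \<le> ereal (1 - t) * g P + ereal t * g P'"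
    using assms t unfolding convex_ext_def by auto
  also have "\<dots> \<le> ereal (1 - t) * ereal v + ereal t * ereal v'"
    by (intro add_mono ereal_mult_left_mono le) (use t in auto)
  finally show "g ((1 - t) *\<^sub>R P + t *\<^sub>R P') \<le> ereal ((1 - t) * v + t * v')" by simp
qed

lemma convex_ext_le_graph_hull:
  assumes "convex_ext g" "\<forall>Z\<in>D. g (\<pi> Z) \<le> ereal (\<phi> Z)" "(P, v) \<in> graph_hull \<pi> \<phi> D"
  shows "g P \<le> ereal v"
proof -
  have "graph_hull \<pi> \<phi> D \<subseteq> {(P, v). g P \<le> ereal v}"
    unfolding graph_hull_def using assms(2)
    by (intro hull_minimal convex_epigraph[OF assms(1)]) auto
  with assms(3) show ?thesis by auto
qed

lemma convex_ext_le_hull_fun: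
  assumes "convex_ext g" "\<forall>Z\<in>D. g (\<pi> Z) \<le> ereal (\<phi> Z)"
  shows "g P \<le> hull_fun \<pi> \<phi> D P"
  unfolding hull_fun_def using convex_ext_le_graph_hull[OF assms] by (intro INF_greatest) auto

lemma hull_fun_le: "(P, v) \<in> graph_hull \<pi> \<phi> D \<Longrightarrow> hull_fun \<pi> \<phi> D P \<le> ereal v"
  unfolding hull_fun_def by (rule INF_lower) simp

lemma hull_fun_le_at: "Z \<in> D \<Longrightarrow> hull_fun \<pi> \<phi> D (\<pi> Z) \<le> ereal (\<phi> Z)"
  by (rule hull_fun_le) (auto simp: graph_hull_def intro: hull_inc)

text \<open>The minorant \<open>g\<close> excludes the value \<open>-\<infinity>\<close>. Convexity
  comes from combining hull points whose heights are within \<open>e\<close> of the two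
  infima.\<close>

lemma convex_ext_hull_fun:
  assumes g: "convex_ext g" and le: "\<forall>Z\<in>D. g (\<pi> Z) \<le> ereal (\<phi> Z)"
  shows "convex_ext (hull_fun \<pi> \<phi> D)"
proof -
  let ?h = "hull_fun \<pi> \<phi> D"
  have no_minus: "?h P \<noteq> - \<infinity>" for P
    using convex_ext_le_hull_fun[OF g le, of P] g unfolding convex_ext_def no_minus_inf_def by fastforce
  have "?h ((1 - t) *\<^sub>R x + t *\<^sub>R y) \<le> ereal (1 - t) * ?h x + ereal t * ?h y"
    if t: "t \<in> {0..1}" for x y t
  \<comment> \<open>For \<open>t\<close> equal to 0 or 1 the convention
    \<open>0 * \<infinity> = 0\<close> makes both sides equal; for other \<open>t\<close> an
    infinite value makes the right side infinite.\<close>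
  proof (cases "t = 0 \<or> t = 1 \<or> ?h x = \<infinity> \<or> ?h y = \<infinity>")
    case True
    then show ?thesis
      using t no_minus[of x] no_minus[of y]
      by (cases "?h x"; cases "?h y") (auto simp: zero_ereal_def[symmetric] one_ereal_def[symmetric])
  next
    case False
    then obtain a b where ab: "?h x = ereal a" "?h y = ereal b"
      using no_minus[of x] no_minus[of y] by (cases "?h x"; cases "?h y") auto
    show ?thesis
    proof (rule ereal_le_epsilon2)
      fix e :: real assume "0 < e"
      then have "?h x < ereal (a + e)" "?h y < ereal (b + e)" by (simp_all add: ab)
      then obtain v w where v: "(x, v) \<in> graph_hull \<pi> \<phi> D" "v < a + e"
        and w: "(y, w) \<in> graph_hull \<pi> \<phi> D" "w < b + e"
        unfolding hull_fun_def INF_less_iff by auto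
      have "(1 - t) *\<^sub>R (x, v) + t *\<^sub>R (y, w) \<in> graph_hull \<pi> \<phi> D"
        using v w t unfolding graph_hull_def
        by (intro convexD_alt convex_convex_hull) auto
      then have "?h ((1 - t) *\<^sub>R x + t *\<^sub>R y) \<le> ereal ((1 - t) * v + t * w)"
        by (intro hull_fun_le) simp
      also have "(1 - t) * v + t * w \<le> (1 - t) * (a + e) + t * (b + e)"
        using v w t by (intro add_mono mult_left_mono) auto
      also have "\<dots> = (1 - t) * a + t * b + e" by (simp add: algebra_simps)
      finally show "?h ((1 - t) *\<^sub>R x + t *\<^sub>R y) \<le> ereal (1 - t) * ?h x + ereal t * ?h y + ereal e"
        by (simp add: ab)
    qed
  qed
  with no_minus show ?thesis by (auto simp: convex_ext_def no_minus_inf_def)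
qed

text \<open>\<open>hull_fun\<close> composed with \<open>minors\<close> is itself the largest
  polyconvex minorant; the existence of some minorant keeps it away from
  \<open>-\<infinity>\<close>.\<close>

lemma polyconvex_envelope_eq_hull_fun:
  assumes f: "\<And>Z. Z \<in> effdom f \<Longrightarrow> f Z = ereal (\<phi> Z)"
    and minorant: "\<exists>h. polyconvex h \<and> h \<le> f"
  shows "polyconvex_envelope f X = hull_fun minors \<phi> (effdom f) (minors X)"
proof (rule antisym)
  have minorant_le: "\<forall>Z\<in>effdom f. g (minors Z) \<le> ereal (\<phi> Z)" if "g \<circ> minors \<le> f" for g
    using that f by (metis comp_apply le_funD)
  show "polyconvex_envelope f X \<le> hull_fun minors \<phi> (effdom f) (minors X)"
    unfolding polyconvex_envelope_def
  proof (rule SUP_least)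
    fix h assume "h \<in> {h. polyconvex h \<and> h \<le> f}"
    then obtain g where g: "convex_ext g" "h = g \<circ> minors" "g \<circ> minors \<le> f"
      by (auto simp: polyconvex_def)
    then show "h X \<le> hull_fun minors \<phi> (effdom f) (minors X)"
      using convex_ext_le_hull_fun[OF g(1) minorant_le[OF g(3)]] by simp
  qed
  obtain g where g: "convex_ext g" "g \<circ> minors \<le> f"
    using minorant by (auto simp: polyconvex_def)
  have "convex_ext (hull_fun minors \<phi> (effdom f))"
    by (rule convex_ext_hull_fun[OF g(1) minorant_le[OF g(2)]])
  then have "polyconvex (hull_fun minors \<phi> (effdom f) \<circ> minors)"
    unfolding polyconvex_def by blast
  moreover have "hull_fun minors \<phi> (effdom f) \<circ> minors \<le> f"
  proof (rule le_funI)
    fix Z show "(hull_fun minors \<phi> (effdom f) \<circ> minors) Z \<le> f Z"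
    proof (cases "Z \<in> effdom f")
      case True
      then show ?thesis using hull_fun_le_at[of Z "effdom f" minors \<phi>] by (simp only: f comp_apply)
    next
      case False
      then show ?thesis by (simp add: effdom_def)
    qed
  qed
  ultimately have "(hull_fun minors \<phi> (effdom f) \<circ> minors) X \<le> polyconvex_envelope f X"
    unfolding polyconvex_envelope_def by (intro SUP_upper) blast
  then show "hull_fun minors \<phi> (effdom f) (minors X) \<le> polyconvex_envelope f X" by simp
qed

section \<open>Feasible vectors of the relaxation\<close>

text \<open>\<open>point_measure\<close> lives on \<open>A\<close> with all its subsets; pushing it
  forward along the identity gives a Borel measure on all matrices.\<close>

lemma exists_atomic_measure:
  fixes A :: "('m::finite, 'n::finite) rmat set" and w :: "('m, 'n) rmat \<Rightarrow> real"
  assumes A: "finite A" and w: "\<And>Z. Z \<in> A \<Longrightarrow> 0 < w Z"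
  shows "\<exists>\<mu>. atomic_measure_on \<mu> A \<and>
    (\<forall>h\<in>borel_measurable borel. integrable \<mu> h \<and> (\<integral>Z. h Z \<partial>\<mu>) = (\<Sum>Z\<in>A. w Z * h Z))"
proof -
  let ?P = "point_measure A (\<lambda>Z. ennreal (w Z))"
  define \<mu> where "\<mu> = distr ?P borel (\<lambda>Z. Z)"
  have meas: "(\<lambda>Z. Z) \<in> measurable ?P borel" by simp
  have sets: "sets \<mu> = sets borel" by (simp add: \<mu>_def)
  have em: "emeasure \<mu> B = (\<Sum>Z\<in>A \<inter> B. ennreal (w Z))" if "B \<in> sets borel" for B
  proof -
    have "emeasure \<mu> B = emeasure ?P (A \<inter> B)"
      using that by (simp add: \<mu>_def emeasure_distr[OF meas] space_point_measure Int_commute)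
    then show ?thesis using A by (simp add: emeasure_point_measure_finite)
  qed
  have "emeasure \<mu> (space \<mu>) = ennreal (sum w A)"
    using em[of UNIV] w by (simp add: \<mu>_def less_imp_le sum_ennreal)
  then have "finite_measure \<mu>"
    by (intro finite_measureI) simp
  moreover have "emeasure \<mu> {Z} > 0" if "Z \<in> A" for Z
    using em[of "{Z}"] that w by simp
  moreover have "emeasure \<mu> (- A) = 0"
    using em[of "- A"] finite_imp_closed[OF A] by simp
  moreover have "integrable \<mu> h \<and> (\<integral>Z. h Z \<partial>\<mu>) = (\<Sum>Z\<in>A. w Z * h Z)"
    if "h \<in> borel_measurable borel" for h
  proof -
    have "integrable ?P h" "(\<integral>Z. h Z \<partial>?P) = (\<Sum>Z\<in>A. w Z * h Z)"
      using A w
      by (auto simp: integrable_point_measure_finite less_imp_le lebesgue_integral_point_measure_finite)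
    then show ?thesis
      using that by (simp add: \<mu>_def integrable_distr_eq[OF meas] integral_distr[OF meas])
  qed
  ultimately show ?thesis
    using sets A by (intro exI[of _ \<mu>]) (auto simp: atomic_measure_on_def)
qed

lemma borel_measurable_monom_val: "monom_val a \<in> borel_measurable borel"
  unfolding monom_val_def case_prod_unfold
  by (intro borel_measurable_continuous_onI continuous_intros)

text \<open>The moments of the Dirac measure at \<open>Z\<close>, cut off to fit
  \<open>trunc_seq\<close>.\<close>

definition trunc_moments :: "nat \<Rightarrow> ('m::finite, 'n::finite) rmat \<Rightarrow> ('m, 'n) midx \<Rightarrow> real" where
  "trunc_moments k Z a = (if midx_deg a \<le> 2 * k then monom_val a Z else 0)"

lemma riesz_trunc_moments: "poly_deg p \<le> 2 * k \<Longrightarrow> riesz (trunc_moments k Z) p = poly_val p Z"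
  unfolding poly_val_eq_riesz poly_deg_le_iff by (rule riesz_cong) (simp add: trunc_moments_def)

lemma sos_cone_deg: "\<sigma> \<in> sos_cone k \<Longrightarrow> poly_deg \<sigma> \<le> 2 * k"
proof -
  assume "\<sigma> \<in> sos_cone k"
  then obtain qs where \<sigma>: "\<sigma> = (\<Sum>q\<leftarrow>qs. q * q)" and qs: "\<forall>q\<in>set qs. poly_deg q \<le> k"
    by (auto simp: sos_cone_def)
  have "poly_deg (q * q) \<le> 2 * k" if "poly_deg q \<le> k" for q :: "('a, 'b) mpoly"
    using poly_deg_mult_le[OF that that] by simp
  with qs show ?thesis unfolding \<sigma> by (induction qs) (auto intro: poly_deg_add_le)
qed

lemma sos_cone_nonneg: "\<sigma> \<in> sos_cone k \<Longrightarrow> 0 \<le> poly_val \<sigma> Z"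
proof -
  assume "\<sigma> \<in> sos_cone k"
  then obtain qs where "\<sigma> = (\<Sum>q\<leftarrow>qs. q * q)" by (auto simp: sos_cone_def)
  moreover have "0 \<le> poly_val (\<Sum>q\<leftarrow>qs. q * q) Z"
    by (induction qs) (auto simp: poly_val_add poly_val_mult)
  ultimately show ?thesis by simp
qed

lemma sos_cone_mono: "k \<le> l \<Longrightarrow> sos_cone k \<subseteq> sos_cone l"
  unfolding sos_cone_def by force

lemma square_in_sos_cone: "poly_deg p \<le> k \<Longrightarrow> p * p \<in> sos_cone k"
  unfolding sos_cone_def by (intro CollectI exI[of _ "[p]"]) simp

lemma trunc_moments_in_pseudo_moment_cone:
  assumes "\<forall>i\<in>{1..s}. 0 \<le> poly_val (g i) Z"
  shows "trunc_moments k Z \<in> pseudo_moment_cone s g k"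
  using assms unfolding pseudo_moment_cone_def trunc_seq_def
  by (auto simp: riesz_trunc_moments sos_cone_deg sos_cone_nonneg poly_val_mult)
     (simp add: trunc_moments_def)

lemma riesz_combination:
  "riesz (\<lambda>a. u * y a + v * z a) p = u * riesz y p + v * riesz z p"
  by (simp add: riesz_def sum_distrib_left sum.distrib algebra_simps)

lemma pseudo_moment_cone_combination:
  assumes "y \<in> pseudo_moment_cone s g k" "z \<in> pseudo_moment_cone s g k" "0 \<le> u" "0 \<le> v"
  shows "(\<lambda>a. u * y a + v * z a) \<in> pseudo_moment_cone s g k"
  using assms unfolding pseudo_moment_cone_def trunc_seq_def by (auto simp: riesz_combination)

text \<open>The pairs of minors and objective value reached by normalised vectors of the cone form a
  convex set \<open>M\<close>. Dirac moments put the graph into \<open>M\<close>, so the hull lies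
  in it as well.\<close>

lemma graph_hull_imp_feasible:
  fixes q :: "('m::{finite,linorder}, 'n::{finite,linorder}) mpoly"
  assumes D: "D = {Z. \<forall>i\<in>{1..s}. 0 \<le> poly_val (g i) Z}"
    and deg: "poly_deg q \<le> 2 * k" "CARD('m) \<le> 2 * k"
    and hull: "(minors X, v) \<in> graph_hull minors (poly_val q) D"
  shows "\<exists>y\<in>mom_feasible s g k X. riesz y q = v"
proof -
  define M where "M = {(P, v). \<exists>y\<in>pseudo_moment_cone s g k. riesz y 1 = 1 \<and>
    (\<chi> c. riesz y (minor_poly c)) = P \<and> riesz y q = v}"
  have "convex M"
    unfolding convex_def
  proof (intro ballI allI impI)
    fix p p' and u u' :: real
    assume "p \<in> M" "p' \<in> M" and u: "0 \<le> u" "0 \<le> u'" "u + u' = 1"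
    then obtain y y' where y: "y \<in> pseudo_moment_cone s g k" "riesz y 1 = 1"
        "p = ((\<chi> c. riesz y (minor_poly c)), riesz y q)"
      and y': "y' \<in> pseudo_moment_cone s g k" "riesz y' 1 = 1"
        "p' = ((\<chi> c. riesz y' (minor_poly c)), riesz y' q)"
      by (auto simp: M_def)
    have "(\<lambda>a. u * y a + u' * y' a) \<in> pseudo_moment_cone s g k"
      using y y' u by (intro pseudo_moment_cone_combination)
    then show "u *\<^sub>R p + u' *\<^sub>R p' \<in> M"
      using y y' u unfolding M_def
      by (auto simp: riesz_combination Finite_Cartesian_Product.vec_eq_iff
          intro!: bexI[of _ "\<lambda>a. u * y a + u' * y' a"])
  qed
  moreover have "(minors Z, poly_val q Z) \<in> M" if "Z \<in> D" for Z
  proof -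
    have "poly_deg (minor_poly c) \<le> 2 * k" for c :: "('m, 'n) minor_idx"
      using poly_deg_minor_poly_le[of c] deg by simp
    then show ?thesis
      using that deg trunc_moments_in_pseudo_moment_cone[of s g Z k] unfolding M_def D
      by (auto simp: riesz_trunc_moments poly_val_minor_poly minors_def
          Finite_Cartesian_Product.vec_eq_iff intro!: bexI[of _ "trunc_moments k Z"])
  qed
  ultimately have "graph_hull minors (poly_val q) D \<subseteq> M"
    unfolding graph_hull_def by (intro hull_minimal) auto
  with hull show ?thesis by (auto simp: M_def mom_feasible_def)
qed

text \<open>The test polynomials of order \<open>k\<close> are also tests of order \<open>l\<close>
  and involve only moments that are kept; \<open>CARD('m) \<le> 2 * k\<close> ensures the same for
  the minors.\<close>

lemma truncate_feasible:
  fixes y :: "('m::{finite,linorder}, 'n::{finite,linorder}) midx \<Rightarrow> real"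
  assumes y: "y \<in> mom_feasible s g l X" and "k \<le> l" and card: "CARD('m) \<le> 2 * k"
    and z: "z = (\<lambda>a. if midx_deg a \<le> 2 * k then y a else 0)"
  shows "z \<in> mom_feasible s g k X"
proof -
  have eq: "riesz z p = riesz y p" if "poly_deg p \<le> 2 * k" for p
    using that unfolding z poly_deg_le_iff by (intro riesz_cong) auto
  have minor: "riesz z (minor_poly c) = riesz y (minor_poly c)" for c
    using poly_deg_minor_poly_le[of c] card by (intro eq) simp
  have pc: "y \<in> pseudo_moment_cone s g l" using y by (simp add: mom_feasible_def)
  have "z \<in> pseudo_moment_cone s g k"
    unfolding pseudo_moment_cone_def
  proof (intro CollectI conjI ballI impI)
    show "z \<in> trunc_seq k" by (simp add: trunc_seq_def z)
    fix \<sigma> :: "('m, 'n) mpoly" assume \<sigma>: "\<sigma> \<in> sos_cone k"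
    then have \<sigma>l: "\<sigma> \<in> sos_cone l" using sos_cone_mono[OF \<open>k \<le> l\<close>] by blast
    show "0 \<le> riesz z \<sigma>"
      using pc \<sigma>l eq[OF sos_cone_deg[OF \<sigma>]] by (simp add: pseudo_moment_cone_def)
    fix i assume "i \<in> {1..s}" "poly_deg (g i * \<sigma>) \<le> 2 * k"
    then show "0 \<le> riesz z (g i * \<sigma>)"
      using pc \<sigma>l eq[of "g i * \<sigma>"] \<open>k \<le> l\<close> by (simp add: pseudo_moment_cone_def)
  qed
  then show ?thesis
    using y by (simp add: mom_feasible_def eq minor)
qed

section \<open>Flat extension\<close>

lemma indep_columns_mono: "indep_columns B F S \<Longrightarrow> B \<subseteq> B' \<Longrightarrow> indep_columns B' F S"
  unfolding indep_columns_def by blast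

lemma moment_matrix_alt:
  fixes y :: "('m::finite, 'n::finite) midx \<Rightarrow> real"
  shows "moment_matrix j y = Matrix.mat (length (midx_list j :: ('m, 'n) midx list))
    (length (midx_list j :: ('m, 'n) midx list))
    (\<lambda>(i, l). y (midx_list j ! i + midx_list j ! l))"
  by (simp add: moment_matrix_def Let_def mult_single riesz_single)

text \<open>\<open>S\<close> indexes a maximal independent set of columns of the smaller matrix.
  Additional rows preserve independence, and since the ranks agree, the same indices span the
  columns of the larger matrix.\<close>

lemma flat_functional_if_rank_eq:
  fixes y :: "('m::finite, 'n::finite) midx \<Rightarrow> real"
  assumes d: "1 \<le> d" "d \<le> k"
    and psd: "\<forall>\<sigma>\<in>sos_cone k. 0 \<le> riesz y \<sigma>"
    and rank: "mat_rank (moment_matrix k y) = mat_rank (moment_matrix (k - d) y)"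
  shows "\<exists>S. flat_functional y k d S \<and> card S = mat_rank (moment_matrix k y)"
proof -
  let ?F = "\<lambda>b a. y (b + a)"
  let ?A = "\<lambda>j. {a :: ('m, 'n) midx. midx_deg a \<le> j}"
  have "\<exists>S\<subseteq>?A (k - d). card S = mat_rank (moment_matrix (k - d) y) \<and> indep_columns (?A (k - d)) ?F S"
    unfolding moment_matrix_alt midx_list(2)[symmetric] by (rule exists_indep_columns_rank)
  then obtain S where S: "S \<subseteq> ?A (k - d)" "card S = mat_rank (moment_matrix k y)"
    and ind: "indep_columns (?A (k - d)) ?F S"
    unfolding rank by (elim exE conjE)
  have sub: "?A (k - d) \<subseteq> ?A k" by auto
  have ind': "indep_columns (?A k) ?F S" by (rule indep_columns_mono[OF ind sub])
  have fin: "finite S"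
    using S(1) by (rule finite_subset) (simp flip: midx_list(2))
  have "flat_functional y k d S"
  proof
    fix p :: "('m, 'n) mpoly" assume "poly_deg p \<le> k"
    then show "0 \<le> riesz y (p * p)" using psd square_in_sos_cone by blast
  next
    fix a :: "('m, 'n) midx" assume "midx_deg a \<le> k"
    then have "\<exists>c. \<forall>b\<in>set (midx_list k). ?F b a = (\<Sum>s\<in>S. c s * ?F b s)"
      using S sub ind'
      by (intro indep_columns_rank_span) (auto simp: midx_list(2) moment_matrix_alt)
    then show "\<exists>c. \<forall>b. midx_deg b \<le> k \<longrightarrow> y (a + b) = (\<Sum>s\<in>S. c s * y (s + b))"
      by (simp add: midx_list(2) add.commute)
  next
    fix c s assume zero: "\<forall>b. midx_deg b \<le> k \<longrightarrow> (\<Sum>s\<in>S. c s * y (s + b)) = 0" and s: "s \<in> S"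
    have "\<forall>b\<in>?A k. (\<Sum>s\<in>S. c s * y (b + s)) = 0"
      using zero by (simp add: add.commute)
    then show "c s = 0"
      using ind'[unfolded indep_columns_def, THEN spec, of c] s by blast
  qed (use d S fin in auto)
  with S show ?thesis by blast
qed

lemma flat_extension:
  fixes y :: "('m::finite, 'n::finite) midx \<Rightarrow> real"
  assumes y: "y \<in> pseudo_moment_cone s g k" and d: "1 \<le> d" "d \<le> k"
    and deg: "\<forall>i\<in>{1..s}. poly_deg (g i) \<le> d"
    and rank: "mat_rank (moment_matrix k y) = mat_rank (moment_matrix (k - d) y)"
  shows "\<exists>A w. finite A \<and> card A = mat_rank (moment_matrix k y) \<and> (\<forall>Z\<in>A. 0 < w Z) \<and>
    (\<forall>p. poly_deg p \<le> 2 * k \<longrightarrow> riesz y p = (\<Sum>Z\<in>A. w Z * poly_val p Z)) \<and>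
    (\<forall>Z\<in>A. \<forall>i\<in>{1..s}. 0 \<le> poly_val (g i) Z)"
proof -
  obtain S where "flat_functional y k d S" and S: "card S = mat_rank (moment_matrix k y)"
    using flat_functional_if_rank_eq[OF d _ rank] y by (auto simp: pseudo_moment_cone_def)
  then interpret flat_functional y k d S by simp
  have "0 \<le> poly_val (g i) Z" if Z: "Z \<in> atoms" and i: "i \<in> {1..s}" for Z i
  proof -
    let ?e = "interp Z"
    \<comment> \<open>The square of the interpolation polynomial isolates the atom \<open>Z\<close>.
      Its factors have degree at most \<open>k - d\<close>, which leaves room for \<open>g i\<close>
      of degree at most \<open>d\<close>.\<close>
    have "poly_deg (g i * (?e * ?e)) \<le> d + ((k - d) + (k - d))"
      using deg i by (intro poly_deg_mult_le interp_deg Z) auto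
    then have le: "poly_deg (g i * (?e * ?e)) \<le> 2 * k" using d by simp
    have "0 \<le> L (g i * (?e * ?e))"
      using y i le square_in_sos_cone[OF deg_le_k[OF interp_deg[OF Z]]]
      unfolding pseudo_moment_cone_def by blast
    also have "\<dots> = (\<Sum>Z'\<in>atoms. weight Z' * (poly_val (g i) Z' * (if Z' = Z then 1 else 0)))"
      by (simp add: L_eq_sum[OF le] poly_val_mult interp_eval Z cong: sum.cong)
        (intro sum.cong, auto simp: interp_eval Z)
    also have "\<dots> = weight Z * poly_val (g i) Z"
      using finite_atoms Z by (simp add: if_distrib cong: if_cong)
    finally show ?thesis using weight_pos[OF Z] by (simp add: zero_le_mult_iff)
  qed
  then show ?thesis
    using finite_atoms card_atoms S weight_pos L_eq_sum
    by (intro exI[of _ atoms] exI[of _ weight]) auto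
qed

text \<open>For \<open>k \<ge> kstar\<close> three inequalities close a circle: the envelope is at
  most \<open>riesz ystar q\<close>, this is at most \<open>f_mom q s g k X\<close>, and that is at
  most the envelope.\<close>

theorem proposition3p2:
  fixes f :: "('m::{finite,linorder}, 'n::{finite,linorder}) rmat \<Rightarrow> ereal"
    and q :: "('m, 'n) mpoly"
    and g :: "nat \<Rightarrow> ('m, 'n) mpoly"
    and s d_g kstar r :: nat
    and X :: "('m, 'n) rmat"
    and ystar :: "('m, 'n) midx \<Rightarrow> real"
  assumes f_range: "no_minus_inf f"
    and f_dom: "effdom f = {Z. \<forall>i\<in>{1..s}. 0 \<le> poly_val (g i) Z}"
    and f_poly: "\<forall>Z\<in>effdom f. f Z = ereal (poly_val q Z)"
    and f_minorant: "\<exists>h. polyconvex h \<and> h \<le> f"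
    and s_pos: "1 \<le> s"
    and d_g_def: "d_g = Max ((\<lambda>i. poly_deg (g i)) ` {1..s})"
    and d_g_pos: "1 \<le> d_g"
    and kstar_ge: "d_g \<le> kstar" "Max {poly_deg q, CARD('m), CARD('n)} \<le> 2 * kstar"
    and optimal: "mom_optimal q s g kstar X ystar"
    and r_def: "r = mat_rank (moment_matrix kstar ystar)"
    and flat: "r = mat_rank (moment_matrix (kstar - d_g) ystar)"
  shows "(\<forall>k\<ge>kstar. f_mom q s g k X = polyconvex_envelope f X) \<and>
    (\<exists>\<mu> (Xs :: nat \<Rightarrow> ('m, 'n) rmat).
       moment_vector_of kstar ystar \<mu> \<and> inj_on Xs {1..r} \<and> Xs ` {1..r} \<subseteq> effdom f \<and>
       atomic_measure_on \<mu> (Xs ` {1..r}))"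
proof -
  have deg_q: "poly_deg q \<le> 2 * kstar" and card_m: "CARD('m) \<le> 2 * kstar"
    using kstar_ge(2) by auto
  have feasible: "ystar \<in> mom_feasible s g kstar X"
    and opt: "\<And>y. y \<in> mom_feasible s g kstar X \<Longrightarrow> riesz ystar q \<le> riesz y q"
    using optimal by (auto simp: mom_optimal_def)
  have cone: "ystar \<in> pseudo_moment_cone s g kstar" using feasible by (simp add: mom_feasible_def)
  have deg_g: "\<forall>i\<in>{1..s}. poly_deg (g i) \<le> d_g"
    unfolding d_g_def by auto
  have rank: "mat_rank (moment_matrix kstar ystar) = mat_rank (moment_matrix (kstar - d_g) ystar)"
    using r_def flat by simp
  from flat_extension[OF cone d_g_pos kstar_ge(1) deg_g rank]
  obtain A w where A: "finite A" "card A = mat_rank (moment_matrix kstar ystar)"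
    and w: "\<forall>Z\<in>A. 0 < w Z"
    and rep: "\<forall>p. poly_deg p \<le> 2 * kstar \<longrightarrow> riesz ystar p = (\<Sum>Z\<in>A. w Z * poly_val p Z)"
    and A_dom: "\<forall>Z\<in>A. \<forall>i\<in>{1..s}. 0 \<le> poly_val (g i) Z"
    by (elim exE conjE)
  have A_sub: "A \<subseteq> effdom f" using A_dom by (auto simp: f_dom)

  let ?env = "hull_fun minors (poly_val q) (effdom f) (minors X)"
  \<comment> \<open>\<open>f_minorant\<close> rules out that the envelope is the supremum of the
    empty set, \<open>-\<infinity>\<close>.\<close>
  have env: "polyconvex_envelope f X = ?env"
    using polyconvex_envelope_eq_hull_fun[of f "poly_val q" X] f_poly f_minorant by blast
  have sum_w: "sum w A = 1"
    using rep[rule_format, of 1] feasible by (simp add: mom_feasible_def)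
  \<comment> \<open>The atoms give a convex combination of graph points; feasibility of
    \<open>ystar\<close> places it over \<open>minors X\<close>, at height
    \<open>riesz ystar q\<close>.\<close>
  have "(\<Sum>Z\<in>A. w Z *\<^sub>R (minors Z, poly_val q Z)) \<in> graph_hull minors (poly_val q) (effdom f)"
    unfolding graph_hull_def
    by (intro convex_sum[OF A(1) convex_convex_hull sum_w])
       (use w A_sub in \<open>auto intro!: hull_inc simp: less_imp_le\<close>)
  moreover have "(\<Sum>Z\<in>A. w Z *\<^sub>R minors Z) = minors X"
  proof -
    have "riesz ystar (minor_poly c) = (\<Sum>Z\<in>A. w Z * minor (\<lambda>i j. Z $ i $ j) c)" for c
      using rep[rule_format, of "minor_poly c"] poly_deg_minor_poly_le[of c] card_m
      by (simp add: poly_val_minor_poly)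
    moreover have "(\<chi> c. riesz ystar (minor_poly c)) = minors X"
      using feasible by (simp add: mom_feasible_def)
    ultimately show ?thesis
      by (simp add: Finite_Cartesian_Product.vec_eq_iff minors_def sum_component)
  qed
  ultimately have env_le: "?env \<le> ereal (riesz ystar q)"
    by (intro hull_fun_le) (simp add: rep[rule_format, OF deg_q] sum_prod)

  have "f_mom q s g k X = polyconvex_envelope f X" if k: "kstar \<le> k" for k
  proof (rule antisym)
    have "f_mom q s g k X \<le> ereal v" if "(minors X, v) \<in> graph_hull minors (poly_val q) (effdom f)" for v
    proof -
      have "\<exists>y\<in>mom_feasible s g k X. riesz y q = v"
        using graph_hull_imp_feasible[OF f_dom _ _ that, of k] deg_q card_m k by simp
      then show ?thesis unfolding f_mom_def by (auto intro: INF_lower2)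
    qed
    then show "f_mom q s g k X \<le> polyconvex_envelope f X"
      unfolding env hull_fun_def by (intro INF_greatest) auto
    \<comment> \<open>A feasible vector of order \<open>k\<close> truncates to one of order
      \<open>kstar\<close> with the same objective value, and there \<open>ystar\<close> is
      optimal.\<close>
    have "ereal (riesz ystar q) \<le> ereal (riesz y q)" if y: "y \<in> mom_feasible s g k X" for y
    proof -
      let ?z = "\<lambda>a. if midx_deg a \<le> 2 * kstar then y a else 0"
      have "riesz ?z q = riesz y q"
        using deg_q unfolding poly_deg_le_iff by (intro riesz_cong) auto
      then show ?thesis using opt[OF truncate_feasible[OF y k card_m refl]] by simp
    qed
    then have "ereal (riesz ystar q) \<le> f_mom q s g k X"
      unfolding f_mom_def by (intro INF_greatest)
    with env_le show "polyconvex_envelope f X \<le> f_mom q s g k X"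
      unfolding env by (rule order_trans)
  qed
  moreover have "\<exists>\<mu> (Xs :: nat \<Rightarrow> ('m, 'n) rmat). moment_vector_of kstar ystar \<mu> \<and>
      inj_on Xs {1..r} \<and> Xs ` {1..r} \<subseteq> effdom f \<and> atomic_measure_on \<mu> (Xs ` {1..r})"
  proof -
    obtain \<mu> where \<mu>: "atomic_measure_on \<mu> A"
      and int: "\<forall>h\<in>borel_measurable borel. integrable \<mu> h \<and> (\<integral>Z. h Z \<partial>\<mu>) = (\<Sum>Z\<in>A. w Z * h Z)"
      using exists_atomic_measure[OF A(1), of w] w by blast
    have "ystar a = (\<Sum>Z\<in>A. w Z * monom_val a Z)" if "midx_deg a \<le> 2 * kstar" for a
      using rep[rule_format, OF poly_deg_single_le[OF that, of 1]] by (simp add: riesz_single)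
    then have "moment_vector_of kstar ystar \<mu>"
      using int borel_measurable_monom_val unfolding moment_vector_of_def by auto
    moreover have "card {1..r} = card A" using A r_def by simp
    then obtain Xs where "bij_betw Xs {1..r} A"
      using bij_betw_iff_card[of "{1..r}" A] A(1) by auto
    ultimately show ?thesis
      using \<mu> A_sub unfolding bij_betw_def by metis
  qed
  ultimately show ?thesis by blast
qed

end
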